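(* Let $T>0$, $n\in\mathbb{N}$, $p\in[1,\infty)$, and let $D\subset\{u\in BV(0,T;\mathbb{R}^n)\colon u(t)\in\{0,1\}^n \text{ for a.a. } t\in(0,T)\}$ be a set that is bounded in $BV(0,T;\mathbb{R}^n)$ and closed in $L^p(0,T;\mathbb{R}^n)$. For each $k\in\mathbb{N}$, let $I_1^k,\dots,I_{N_k}^k$, $N_k\in\mathbb{N}$, be (nonempty) disjoint open intervals in $(0,T)$ such that (i) $\bigcup_{i=1}^{N_k}\overline{I_i^k}=[0,T]$ for all $k\in\mathbb{N}$, and (ii) $\max_{i=1,\dots,N_k}\lambda(I_i^k)\to 0$ for $k\to\infty$. Set $M_k:=n\,N_k$ and define $\Pi_k\colon L^p(0,T;\mathbb{R}^n)\to\mathbb{R}^{M_k}$ by $$\Pi_k(u)_{(j-1)N_k+i}:=\frac{1}{\lambda(I_i^k)}\int_{I_i^k}u_j(t)\,\mathrm{d}t,\qquad j=1,\dots,n,\ i=1,\dots,N_k.$$ Moreover, set $C_{D,\Pi_k}:=\operatorname{conv}\{\Pi_k(u)\colon u\in D\}\subset\mathbb{R}^{M_k}$ and $$V_k:=\{v\in L^p(0,T;\mathbb{R}^n)\colon \Pi_k(v)\in C_{D,\Pi_k}\}.$$ Then $$\overline{\operatorname{conv}(D)}^{L^p(0,T;\mathbb{R}^n)}=\bigcap_{k\in\mathbb{N}}V_k.$$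
   Context: $\lambda$ denotes the Lebesgue measure. $BV(0,T;\mathbb{R}^n)$ is the space of $u\in L^1(0,T;\mathbb{R}^n)$ all of whose components $u_j$ belong to $BV(0,T)$, with norm $\|u\|_{BV(0,T;\mathbb{R}^n)}=\|u\|_{L^1(0,T;\mathbb{R}^n)}+\sum_{j=1}^n|u_j|_{BV(0,T)}$, where $|\cdot|_{BV(0,T)}$ is the BV-seminorm (total variation of the distributional derivative). $\overline{\operatorname{conv}(D)}^{L^p(0,T;\mathbb{R}^n)}$ is the closure of the convex hull of $D$ in the norm of $L^p(0,T;\mathbb{R}^n)$. *)

theory Defs
  imports "HOL-Analysis.Analysis" "HOL-Library.Function_Algebras"
begin

text \<open>
  Pointwise scalar multiplication makes the functions into a real vector space, so that the
  library's \<^const>\<open>convex\<close> and \<^const>\<open>hull\<close> apply to sets of functions and to sets of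
  finitely indexed vectors alike.
\<close>

instantiation "fun" :: (type, real_vector) real_vector
begin

definition scaleR_fun :: "real \<Rightarrow> ('a \<Rightarrow> 'b) \<Rightarrow> 'a \<Rightarrow> 'b"
  where "scaleR_fun c f = (\<lambda>x. c *\<^sub>R f x)"

instance
  by standard (simp_all add: scaleR_fun_def plus_fun_def fun_eq_iff algebra_simps)

end

text \<open>
  An element of \<open>L\<^sup>p(0,T;\<real>\<^sup>n)\<close> is represented by all functions on \<open>\<real>\<close> that belong to its
  class; values outside \<open>(0,T)\<close> are irrelevant.  A set of classes is represented by the set of all
  representatives of its members.  A set equal to its \<open>Lp_closure\<close> is automatically
  saturated under almost everywhere equality on \<open>(0,T)\<close>, because \<open>Lp_norm\<close> is only a seminorm on
  functions.
\<close>

definition Lp :: "real \<Rightarrow> real \<Rightarrow> (real \<Rightarrow> real ^ 'n) set"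
  where "Lp T p = {u. u \<in> borel_measurable (lebesgue_on {0<..<T}) \<and>
                     integrable (lebesgue_on {0<..<T}) (\<lambda>t. norm (u t) powr p)}"

definition Lp_norm :: "real \<Rightarrow> real \<Rightarrow> (real \<Rightarrow> real ^ 'n) \<Rightarrow> real"
  where "Lp_norm T p u = (LINT t|lebesgue_on {0<..<T}. norm (u t) powr p) powr (1 / p)"

definition Lp_closure :: "real \<Rightarrow> real \<Rightarrow> (real \<Rightarrow> real ^ 'n) set \<Rightarrow> (real \<Rightarrow> real ^ 'n) set"
  where "Lp_closure T p A =
    {v \<in> Lp T p. \<forall>\<epsilon>>0. \<exists>w\<in>A \<inter> Lp T p. Lp_norm T p (\<lambda>t. v t - w t) < \<epsilon>}"

definition Lp_closed :: "real \<Rightarrow> real \<Rightarrow> (real \<Rightarrow> real ^ 'n) set \<Rightarrow> bool"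
  where "Lp_closed T p A \<longleftrightarrow> A \<subseteq> Lp T p \<and> Lp_closure T p A = A"

text \<open>The space \<open>C\<^sub>c\<^sup>\<infinity>(0,T)\<close>, with functions extended by zero to \<open>\<real>\<close>.\<close>

definition test_functions :: "real \<Rightarrow> (real \<Rightarrow> real) set"
  where "test_functions T = {\<phi>. (\<forall>k t. (deriv ^^ k) \<phi> field_differentiable at t) \<and>
                               closure {t. \<phi> t \<noteq> 0} \<subseteq> {0<..<T}}"

definition distributional_deriv :: "real \<Rightarrow> (real \<Rightarrow> real) \<Rightarrow> (real \<Rightarrow> real) \<Rightarrow> real"
  where "distributional_deriv T f \<phi> = - (LINT t|lebesgue_on {0<..<T}. f t * deriv \<phi> t)"

text \<open>
  The total variation of the distributional derivative of \<open>f \<in> L\<^sup>1(0,T)\<close>; it is finite iff this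
  derivative is a finite signed Radon measure on \<open>(0,T)\<close>.
\<close>

definition BV_seminorm :: "real \<Rightarrow> (real \<Rightarrow> real) \<Rightarrow> ereal"
  where "BV_seminorm T f =
    (SUP \<phi> \<in> {\<phi> \<in> test_functions T. \<forall>t. \<bar>\<phi> t\<bar> \<le> 1}. ereal (distributional_deriv T f \<phi>))"

definition BV :: "real \<Rightarrow> (real \<Rightarrow> real ^ 'n) set"
  where "BV T = {u \<in> Lp T 1. \<forall>j. BV_seminorm T (\<lambda>t. u t $ j) < \<infinity>}"

definition BV_norm :: "real \<Rightarrow> (real \<Rightarrow> real ^ 'n) \<Rightarrow> ereal"
  where "BV_norm T u = ereal (Lp_norm T 1 u) + (\<Sum>j\<in>UNIV. BV_seminorm T (\<lambda>t. u t $ j))"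

definition BV_bounded :: "real \<Rightarrow> (real \<Rightarrow> real ^ 'n) set \<Rightarrow> bool"
  where "BV_bounded T A \<longleftrightarrow> A \<subseteq> BV T \<and> (\<exists>C::real. \<forall>u\<in>A. BV_norm T u \<le> ereal C)"

text \<open>
  \<open>\<real>\<^bsup>n N\<^esup>\<close> is represented by the functions on \<open>'n \<times> \<nat>\<close> vanishing outside
  \<open>'n \<times> {1..N}\<close>: the index \<open>(j, i)\<close> stands for the position \<open>(j - 1) N + i\<close>.
\<close>

definition local_averages ::
    "nat \<Rightarrow> (nat \<Rightarrow> real set) \<Rightarrow> (real \<Rightarrow> real ^ 'n) \<Rightarrow> ('n \<times> nat \<Rightarrow> real)"
  where "local_averages N I u =
    (\<lambda>(j, i). if i \<in> {1..N}
              then 1 / measure lebesgue (I i) * (LINT t|lebesgue_on (I i). u t $ j)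
              else 0)"

definition average_hull ::
    "nat \<Rightarrow> (nat \<Rightarrow> real set) \<Rightarrow> (real \<Rightarrow> real ^ 'n) set \<Rightarrow> ('n \<times> nat \<Rightarrow> real) set"
  where "average_hull N I D = convex hull (local_averages N I ` D)"

definition average_relaxation ::
    "real \<Rightarrow> real \<Rightarrow> nat \<Rightarrow> (nat \<Rightarrow> real set) \<Rightarrow> (real \<Rightarrow> real ^ 'n) set \<Rightarrow> (real \<Rightarrow> real ^ 'n) set"
  where "average_relaxation T p N I D =
    {v \<in> Lp T p. local_averages N I v \<in> average_hull N I D}"

end

theory Submission
  imports Defs "HOL-Complex_Analysis.Great_Picard"
begin

text \<open>
  Everything rests on one estimate.  Let \<open>g\<close> be bounded by \<open>2\<close> with integral zero over every cell of a
  partition of \<open>(0,T)\<close>.  Its primitive vanishes at the end points of all cells, hence it is bounded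
  by twice the mesh (\<open>primitive_le_mesh\<close>).  If \<open>f\<close> takes values in \<open>[0,1]\<close> and has total variation at
  most \<open>C\<close>, then integration by parts gives \<open>\<bar>\<integral>f g\<bar> \<le> 2 \<cdot> mesh \<cdot> C\<close>.  As the total variation is defined
  by smooth test functions and the primitive is only Lipschitz continuous, \<open>g\<close> has to be
  approximated in \<open>L\<^sup>1\<close> by derivatives of test functions (\<open>BV_duality_primitive\<close>).

  On the other hand, the \<open>L\<^sup>1\<close> norm of any \<open>e\<close> is the integral of \<open>e\<close> against its sign \<open>s\<close>, and \<open>s\<close> is
  the sum of its cell averages and such a function \<open>g\<close> (\<open>oscillating_multiplier\<close>).  The averaged part
  sees only the cell integrals of \<open>e\<close>.  Two functions in a \<open>BV\<close> ball whose cell integrals are close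
  are therefore close in \<open>L\<^sup>1\<close>, up to a multiple of the mesh.

  The intersection is contained in the closure: if \<open>v\<close> lies in every \<open>V\<^sub>k\<close>, choose \<open>w\<^sub>k \<in> conv D\<close> with the
  same averages as \<open>v\<close> on the \<open>k\<close>-th partition.  The \<open>w\<^sub>k\<close> stay in a convex \<open>BV\<close> ball, so
  \<open>\<integral>\<bar>v - w\<^sub>k\<bar> \<le> \<integral>v g\<^sub>k + O(mesh)\<close>, and \<open>\<integral>v g\<^sub>k \<longlonglongrightarrow> 0\<close> because uniformly bounded functions whose primitives
  tend to zero uniformly converge weakly to zero
  (\<open>L1_tendsto_of_equal_cell_integrals\<close>).  Since all values lie in \<open>[0,1]\<close>, convergence in \<open>L\<^sup>1\<close> is
  convergence in \<open>L\<^sup>p\<close>.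

  The closure is contained in each \<open>V\<^sub>k\<close>: the averaging map is continuous on \<open>L\<^sup>p\<close>, so it suffices that
  the average hull is closed.  The set \<open>D\<close> is sequentially compact: a diagonal argument makes all cell
  integrals on all partitions converge along a subsequence, which by the estimate is then Cauchy in
  \<open>L\<^sup>1\<close> (\<open>unit_BV_ball_compact\<close>).  Hence the averages of \<open>D\<close> form a compact set of vectors with finitely
  many nonzero coordinates, and by Caratheodory's theorem its convex hull is compact
  (\<open>compact_convex_hull_fun\<close>).
\<close>

section \<open>Smooth functions of one real variable\<close>

definition smooth :: "(real \<Rightarrow> real) \<Rightarrow> bool"
  where "smooth f \<longleftrightarrow> (\<forall>k t. (deriv ^^ k) f field_differentiable at t)"

text \<open>
  Any class of functions that is stable under differentiation consists of smooth functions.  This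
  avoids formulas for higher derivatives: each closure property below only needs a class of
  expressions whose first derivatives stay in the class.
\<close>

lemma smooth_coinduct:
  assumes "f \<in> F"
    and "\<And>g. g \<in> F \<Longrightarrow> \<exists>g'\<in>F. \<forall>t. (g has_field_derivative g' t) (at t)"
  shows "smooth f"
proof -
  have step: "deriv g \<in> F \<and> (\<forall>t. g field_differentiable at t)" if g: "g \<in> F" for g
  proof -
    obtain g' where g': "g' \<in> F" "\<forall>t. (g has_field_derivative g' t) (at t)"
      using assms(2)[OF g] by blast
    then have "deriv g = g'" by (intro ext DERIV_imp_deriv) auto
    with g' show ?thesis by (auto simp: field_differentiable_def)
  qed
  have "(deriv ^^ k) f \<in> F" for k
    by (induction k) (use assms(1) step in auto)
  then show ?thesis using step by (auto simp: smooth_def)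
qed

lemma smooth_imp_deriv:
  assumes "smooth f"
  shows "(f has_field_derivative deriv f t) (at t)"
  using assms[unfolded smooth_def, rule_format, of 0 t]
  by (simp add: DERIV_deriv_iff_field_differentiable)

lemma smooth_deriv:
  assumes "smooth f"
  shows "smooth (deriv f)"
  unfolding smooth_def
proof (intro allI)
  fix k t
  have "(deriv ^^ Suc k) f field_differentiable at t"
    using assms unfolding smooth_def by blast
  then show "(deriv ^^ k) (deriv f) field_differentiable at t"
    unfolding funpow_Suc_right by simp
qed

lemma smooth_continuous_on: "smooth f \<Longrightarrow> continuous_on A f"
  by (meson DERIV_isCont continuous_at_imp_continuous_on smooth_imp_deriv)

lemma smooth_antiderivative:
  assumes "smooth h" and "\<And>t. (f has_field_derivative h t) (at t)"
  shows "smooth f"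
proof (rule smooth_coinduct[where F = "insert f {g. smooth g}"])
  show "f \<in> insert f {g. smooth g}" by simp
next
  fix g assume "g \<in> insert f {g. smooth g}"
  then show "\<exists>g'\<in>insert f {g. smooth g}. \<forall>t. (g has_field_derivative g' t) (at t)"
  proof
    assume "g = f" then show ?thesis using assms by (intro bexI[of _ h]) auto
  next
    assume "g \<in> {g. smooth g}"
    then show ?thesis
      by (intro bexI[of _ "deriv g"]) (auto intro: smooth_deriv smooth_imp_deriv)
  qed
qed

lemma smooth_const: "smooth (\<lambda>t. c)"
  by (rule smooth_coinduct[where F = "range (\<lambda>c t. c)"]) (auto intro!: derivative_eq_intros)

lemma smooth_add:
  assumes "smooth f" "smooth g"
  shows "smooth (\<lambda>t. f t + g t)"
proof (rule smooth_coinduct[where F = "{\<lambda>t. f t + g t | f g. smooth f \<and> smooth g}"])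
  show "(\<lambda>t. f t + g t) \<in> {\<lambda>t. f t + g t | f g. smooth f \<and> smooth g}" using assms by blast
next
  fix u assume "u \<in> {\<lambda>t. f t + g t | f g. smooth f \<and> smooth g}"
  then obtain f g where fg: "u = (\<lambda>t. f t + g t)" "smooth f" "smooth g" by blast
  show "\<exists>g'\<in>{\<lambda>t. f t + g t | f g. smooth f \<and> smooth g}. \<forall>t. (u has_field_derivative g' t) (at t)"
    by (rule bexI[of _ "\<lambda>t. deriv f t + deriv g t"])
       (use fg smooth_deriv in \<open>auto intro!: derivative_eq_intros smooth_imp_deriv\<close>)
qed

text \<open>
  The products of smooth functions are not stable under differentiation, but their finite sums are,
  by the product rule.
\<close>

inductive_set product_sums :: "(real \<Rightarrow> real) set" where
  product: "smooth f \<Longrightarrow> smooth g \<Longrightarrow> (\<lambda>t. f t * g t) \<in> product_sums"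
| add: "u \<in> product_sums \<Longrightarrow> v \<in> product_sums \<Longrightarrow> (\<lambda>t. u t + v t) \<in> product_sums"

lemma smooth_mult:
  assumes "smooth f" "smooth g"
  shows "smooth (\<lambda>t. f t * g t)"
proof (rule smooth_coinduct[where F = product_sums])
  show "(\<lambda>t. f t * g t) \<in> product_sums" using assms by (rule product_sums.product)
next
  fix u assume "u \<in> product_sums"
  then show "\<exists>u'\<in>product_sums. \<forall>t. (u has_field_derivative u' t) (at t)"
  proof induction
    case (product f g)
    have "(\<lambda>t. deriv f t * g t + f t * deriv g t) \<in> product_sums"
      using product by (intro product_sums.intros smooth_deriv)
    moreover have "((\<lambda>t. f t * g t) has_field_derivative deriv f t * g t + f t * deriv g t) (at t)" for t
      using product by (auto intro!: derivative_eq_intros smooth_imp_deriv)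
    ultimately show ?case by (intro bexI[of _ "\<lambda>t. deriv f t * g t + f t * deriv g t"]) auto
  next
    case (add u v)
    then obtain u' v' where "u' \<in> product_sums" "\<forall>t. (u has_field_derivative u' t) (at t)"
      "v' \<in> product_sums" "\<forall>t. (v has_field_derivative v' t) (at t)" by blast
    then show ?case
      by (intro bexI[of _ "\<lambda>t. u' t + v' t"])
         (auto intro!: derivative_eq_intros product_sums.intros)
  qed
qed

text \<open>
  The stable class is that of the products \<open>q \<cdot> exp f\<close> with smooth \<open>q\<close>, where
  \<open>(q \<cdot> exp f)' = (q' + q \<cdot> f') \<cdot> exp f\<close>.
\<close>

lemma smooth_exp:
  assumes "smooth f"
  shows "smooth (\<lambda>t. exp (f t))"
proof (rule smooth_coinduct[where F = "{\<lambda>t. q t * exp (f t) | q. smooth q}"])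
  show "(\<lambda>t. exp (f t)) \<in> {\<lambda>t. q t * exp (f t) | q. smooth q}"
    using smooth_const[of 1] by force
next
  fix u assume "u \<in> {\<lambda>t. q t * exp (f t) | q. smooth q}"
  then obtain q where q: "u = (\<lambda>t. q t * exp (f t))" "smooth q" by blast
  show "\<exists>u'\<in>{\<lambda>t. q t * exp (f t) | q. smooth q}. \<forall>t. (u has_field_derivative u' t) (at t)"
  proof (rule bexI[of _ "\<lambda>t. (deriv q t + q t * deriv f t) * exp (f t)"])
    show "\<forall>t. (u has_field_derivative (deriv q t + q t * deriv f t) * exp (f t)) (at t)"
      unfolding q(1) using smooth_imp_deriv[OF q(2)] smooth_imp_deriv[OF assms]
      by (auto intro!: derivative_eq_intros simp: algebra_simps)
    show "(\<lambda>t. (deriv q t + q t * deriv f t) * exp (f t)) \<in> {\<lambda>t. q t * exp (f t) | q. smooth q}"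
      using smooth_add[OF smooth_deriv[OF q(2)] smooth_mult[OF q(2) smooth_deriv[OF assms]]]
      by (intro CollectI exI[of _ "\<lambda>t. deriv q t + q t * deriv f t"] conjI refl)
  qed
qed

lemma smooth_comp_affine:
  assumes "smooth f"
  shows "smooth (\<lambda>t. f (a * t + b))"
proof (rule smooth_coinduct[where F = "{\<lambda>t. c * f (a * t + b) | c f. smooth f}"])
  show "(\<lambda>t. f (a * t + b)) \<in> {\<lambda>t. c * f (a * t + b) | c f. smooth f}"
    using assms by (intro CollectI exI[of _ 1] exI[of _ f]) auto
next
  fix u assume "u \<in> {\<lambda>t. c * f (a * t + b) | c f. smooth f}"
  then obtain c f where cf: "u = (\<lambda>t. c * f (a * t + b))" "smooth f" by blast
  show "\<exists>u'\<in>{\<lambda>t. c * f (a * t + b) | c f. smooth f}. \<forall>t. (u has_field_derivative u' t) (at t)"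
  proof (rule bexI[of _ "\<lambda>t. (c * a) * deriv f (a * t + b)"])
    have "((\<lambda>t. f (a * t + b)) has_field_derivative deriv f (a * t + b) * a) (at t)" for t
      by (rule DERIV_chain2[OF smooth_imp_deriv[OF cf(2)]]) (auto intro!: derivative_eq_intros)
    then show "\<forall>t. (u has_field_derivative (c * a) * deriv f (a * t + b)) (at t)"
      unfolding cf(1) by (auto intro!: derivative_eq_intros)
    show "(\<lambda>t. (c * a) * deriv f (a * t + b)) \<in> {\<lambda>t. c * f (a * t + b) | c f. smooth f}"
      using smooth_deriv[OF cf(2)] by blast
  qed
qed

text \<open>
  The functions \<open>q(1/t) \<cdot> exp (-1/t)\<close> extended by zero to \<open>t \<le> 0\<close>, for all polynomials \<open>q\<close> at once: the
  classical flat function \<open>exp (-1/t)\<close> is the case \<open>q = 1\<close>, and its derivatives are of this form.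
\<close>

definition flat_exp :: "real poly \<Rightarrow> real \<Rightarrow> real"
  where "flat_exp q t = (if t \<le> 0 then 0 else poly q (1 / t) * exp (- (1 / t)))"

lemma poly_times_exp_neg_tendsto_0: "((\<lambda>x::real. poly q x * exp (- x)) \<longlongrightarrow> 0) at_top"
proof -
  have "((\<lambda>x. \<Sum>i\<le>degree q. coeff q i * (x ^ i / exp x)) \<longlongrightarrow> (\<Sum>i\<le>degree q. coeff q i * 0)) at_top"
    by (intro tendsto_sum tendsto_mult tendsto_const tendsto_power_div_exp_0)
  then show ?thesis
    by (simp add: poly_altdef sum_distrib_right exp_minus divide_inverse mult.assoc)
qed

text \<open>
  With \<open>x = 1/t\<close> the chain rule produces the factor \<open>-x\<^sup>2\<close>, so \<open>q\<close> turns into \<open>x\<^sup>2 \<cdot> (q - q')\<close>.  At the origin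
  the difference quotient tends to zero because \<open>exp (-x)\<close> beats every polynomial.
\<close>

lemma flat_exp_has_field_derivative:
  "(flat_exp q has_field_derivative flat_exp ([:0, 0, 1:] * (q - pderiv q)) t) (at t)"
proof (cases t "0::real" rule: linorder_cases)
  case less
  have "((\<lambda>_. 0) has_field_derivative 0) (at t)" by simp
  then have "(flat_exp q has_field_derivative 0) (at t)"
    by (rule has_field_derivative_transform_within_open[where S = "{..<0}"])
       (use less in \<open>auto simp: flat_exp_def\<close>)
  then show ?thesis using less by (simp add: flat_exp_def)
next
  case greater
  have "((\<lambda>t. poly q (1 / t) * exp (- (1 / t))) has_field_derivative
      poly ([:0, 0, 1:] * (q - pderiv q)) (1 / t) * exp (- (1 / t))) (at t)"
    using greater
    by (auto intro!: derivative_eq_intros simp: field_simps power2_eq_square)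
  then have "(flat_exp q has_field_derivative
      poly ([:0, 0, 1:] * (q - pderiv q)) (1 / t) * exp (- (1 / t))) (at t)"
    by (rule has_field_derivative_transform_within_open[where S = "{0<..}"])
       (use greater in \<open>auto simp: flat_exp_def\<close>)
  then show ?thesis using greater by (simp add: flat_exp_def)
next
  case equal
  have "((\<lambda>x. poly ([:0, 1:] * q) (1 / x) * exp (- (1 / x))) \<longlongrightarrow> 0) (at_right 0)"
    using filterlim_compose[OF poly_times_exp_neg_tendsto_0[of "[:0, 1:] * q"] filterlim_inverse_at_top_right]
    by (simp add: inverse_eq_divide)
  then have r: "((\<lambda>x. flat_exp q x / x) \<longlongrightarrow> 0) (at_right 0)"
    by (rule tendsto_cong[THEN iffD1, rotated])
       (auto simp: eventually_at_filter flat_exp_def)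
  have l: "((\<lambda>x. flat_exp q x / x) \<longlongrightarrow> 0) (at_left 0)"
    by (rule tendsto_eventually) (auto simp: eventually_at_filter flat_exp_def)
  have "((\<lambda>x. flat_exp q x / x) \<longlongrightarrow> 0) (at 0)"
    using l r by (simp add: filterlim_split_at)
  then show ?thesis using equal
    by (simp add: has_field_derivative_iff flat_exp_def)
qed

lemma smooth_flat_exp: "smooth (flat_exp q)"
  by (rule smooth_coinduct[where F = "range flat_exp"])
     (auto intro: flat_exp_has_field_derivative)

text \<open>
  If \<open>g\<close> is smooth, positive inside the interval and zero outside, then \<open>1 - exp (-m \<cdot> g)\<close> increases to the
  indicator function as \<open>m\<close> grows.  Such a \<open>g\<close> is a product of two flat functions, one for each end
  point.
\<close>

lemma smooth_approx_indicator:
  fixes a b :: real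
  obtains h where "\<And>m::nat. smooth (h m)" "\<And>m t. h m t \<in> {0..1}" "\<And>m t. t \<notin> {a<..<b} \<Longrightarrow> h m t = 0"
    "\<And>t. (\<lambda>m. h m t) \<longlonglongrightarrow> indicator {a<..<b} t"
proof
  define g where "g t = flat_exp 1 (t - a) * flat_exp 1 (b - t)" for t
  define h where "h = (\<lambda>(m::nat) t. 1 - exp (- real m * g t))"
  have nonneg: "g t \<ge> 0" for t by (simp add: g_def flat_exp_def)
  have "smooth g"
    unfolding g_def
    using smooth_mult[OF smooth_comp_affine[OF smooth_flat_exp, of 1 1 "-a"]
        smooth_comp_affine[OF smooth_flat_exp, of 1 "-1" b]] by simp
  then have "smooth (\<lambda>t. 1 + (- 1) * exp (- real m * g t))" for m
    by (intro smooth_add smooth_mult smooth_exp smooth_const)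
  then show "smooth (h m)" for m by (simp add: h_def)
  show "h m t \<in> {0..1}" for m t using nonneg[of t] by (simp add: h_def)
  have zero: "g t = 0" if "t \<notin> {a<..<b}" for t using that by (auto simp: g_def flat_exp_def)
  show "h m t = 0" if "t \<notin> {a<..<b}" for m t
    using zero[OF that] by (simp add: h_def)
  show "(\<lambda>m. h m t) \<longlonglongrightarrow> indicator {a<..<b} t" for t
  proof (cases "t \<in> {a<..<b}")
    case True
    then have "g t > 0" by (auto simp: g_def flat_exp_def)
    then have "(\<lambda>m. exp (- g t) ^ m) \<longlonglongrightarrow> 0"
      by (intro LIMSEQ_power_zero) auto
    then have "(\<lambda>m. 1 - exp (- g t) ^ m) \<longlonglongrightarrow> 1 - 0"
      by (rule tendsto_diff[OF tendsto_const])
    moreover have "h m t = 1 - exp (- g t) ^ m" for m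
      unfolding h_def by (simp add: exp_of_nat_mult[symmetric] mult.commute)
    ultimately show ?thesis using True by simp
  next
    case False
    then show ?thesis using zero[OF False] by (simp add: h_def)
  qed
qed

section \<open>Approximation in the mean on a bounded interval\<close>

lemma integral_indicator_UN_tendsto_0:
  fixes A :: "nat \<Rightarrow> 'a set"
  assumes "finite_measure M" and A: "\<And>i. A i \<in> sets M"
  shows "(\<lambda>n. LINT t|M. \<bar>indicator (\<Union>i. A i) t - indicator (\<Union>i<n. A i) t :: real\<bar>) \<longlonglongrightarrow> 0"
proof -
  interpret finite_measure M by fact
  have "(\<lambda>n. LINT t|M. \<bar>indicator (\<Union>i. A i) t - indicator (\<Union>i<n. A i) t :: real\<bar>) \<longlonglongrightarrow> (LINT t|M. 0)"
  proof (rule integral_dominated_convergence[where w = "\<lambda>_. 2"])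
    show "AE t in M. (\<lambda>n. \<bar>indicator (\<Union>i. A i) t - indicator (\<Union>i<n. A i) t :: real\<bar>) \<longlonglongrightarrow> 0"
    proof (intro AE_I2)
      fix t
      have "(\<lambda>n. indicator (\<Union>i. A i) t - indicator (\<Union>i<n. A i) t :: real)
          \<longlonglongrightarrow> indicator (\<Union>i. A i) t - indicator (\<Union>i. A i) t"
        by (intro tendsto_diff tendsto_const LIMSEQ_indicator_UN)
      then show "(\<lambda>n. \<bar>indicator (\<Union>i. A i) t - indicator (\<Union>i<n. A i) t :: real\<bar>) \<longlonglongrightarrow> 0"
        by (simp add: tendsto_rabs_zero)
    qed
    show "AE t in M. norm \<bar>indicator (\<Union>i. A i) t - indicator (\<Union>i<n. A i) t :: real\<bar> \<le> 2" for n
      by (auto split: split_indicator)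
  qed (use A in auto)
  then show ?thesis by simp
qed

lemma finite_measure_lebesgue_on_interval: "finite_measure (lebesgue_on {a<..<b::real})"
  by (rule finite_measure_lebesgue_on) auto

text \<open>
  A property of integrable functions on \<open>(0,T)\<close> that is stable under linear combinations and limits in
  \<open>L\<^sup>1\<close> need only be checked for open intervals with end points inside \<open>(0,T)\<close>.  Dynkin's theorem passes
  from intervals to Borel sets, modification on a null set to Lebesgue sets, and simple
  functions to all integrable ones.
\<close>

theorem L1_interval_induct [consumes 1, case_names interval add scale limit]:
  fixes f :: "real \<Rightarrow> real" and T :: real
  defines "M \<equiv> lebesgue_on {0<..<T}"
  assumes f: "integrable M f"
    and interval: "\<And>a b. 0 < a \<Longrightarrow> b < T \<Longrightarrow> P (indicator {a<..<b})"
    and add: "\<And>f g. integrable M f \<Longrightarrow> P f \<Longrightarrow> integrable M g \<Longrightarrow> P g \<Longrightarrow> P (\<lambda>t. f t + g t)"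
    and scale: "\<And>c f. integrable M f \<Longrightarrow> P f \<Longrightarrow> P (\<lambda>t. c * f t)"
    and limit: "\<And>f. integrable M f \<Longrightarrow>
      (\<And>\<epsilon>. \<epsilon> > 0 \<Longrightarrow> \<exists>g. integrable M g \<and> P g \<and> (LINT t|M. \<bar>f t - g t\<bar>) < \<epsilon>) \<Longrightarrow> P f"
  shows "P f"
proof -
  interpret finite_measure M
    unfolding M_def by (rule finite_measure_lebesgue_on_interval)
  have space: "space M = {0<..<T}" by (simp add: M_def)
  have ind_int: "integrable M (indicator A :: real \<Rightarrow> real)" if "A \<in> sets M" for A
    using that by (simp add: less_top[symmetric])
  have sets_M: "A \<in> sets lebesgue \<Longrightarrow> indicator A \<in> borel_measurable M" for A :: "real set"
    unfolding M_def by (intro measurable_restrict_space1) auto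
  have ind_int': "integrable M (indicator A :: real \<Rightarrow> real)" if "A \<in> sets lebesgue" for A
    by (rule integrable_const_bound[where B = 1]) (use sets_M[OF that] in \<open>auto split: split_indicator\<close>)
  have cong: "P f" if "integrable M f" "P g" "AE t in M. f t = g t" "integrable M g" for f g
  proof (rule limit[OF that(1)])
    fix \<epsilon> :: real assume "\<epsilon> > 0"
    have "(LINT t|M. \<bar>f t - g t\<bar>) = (LINT t|M. 0)"
      using that by (intro integral_cong_AE) auto
    with that \<open>\<epsilon> > 0\<close> show "\<exists>g. integrable M g \<and> P g \<and> (LINT t|M. \<bar>f t - g t\<bar>) < \<epsilon>"
      by (intro exI[of _ g]) auto
  qed
  have limit_seq: "P f" if "integrable M f" "\<And>n::nat. P (g n)" "\<And>n. integrable M (g n)"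
    "(\<lambda>n. LINT t|M. \<bar>f t - g n t\<bar>) \<longlonglongrightarrow> 0" for f g
  proof (rule limit[OF that(1)])
    fix \<epsilon> :: real assume "\<epsilon> > 0"
    with that(4) have "\<forall>\<^sub>F n in sequentially. (LINT t|M. \<bar>f t - g n t\<bar>) < \<epsilon>"
      by (rule order_tendstoD)
    then obtain n where "(LINT t|M. \<bar>f t - g n t\<bar>) < \<epsilon>"
      by (auto simp: eventually_sequentially)
    with that show "\<exists>g. integrable M g \<and> P g \<and> (LINT t|M. \<bar>f t - g t\<bar>) < \<epsilon>" by blast
  qed
  have open_interval: "P (indicator {a<..<b})" for a b
  proof (cases "T > 0")
    case T: True
    \<comment> \<open>The end points are moved into the interior of \<open>(0,T)\<close>; any positive null sequence would do.\<close>
    define a' b' where "a' n = max a (T / (real n + 3))" and "b' n = min b (T - T / (real n + 3))" for n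
    have *: "(\<lambda>n. T / (real n + 3)) \<longlonglongrightarrow> 0"
      by real_asymp
    show ?thesis
    proof (rule limit_seq)
      show "P (indicator {a' n<..<b' n})" for n
        by (rule interval) (use T in \<open>auto simp: a'_def b'_def intro!: max.strict_coboundedI2 min.strict_coboundedI2\<close>)
      have "(\<lambda>n. LINT t|M. \<bar>indicator {a<..<b} t - indicator {a' n<..<b' n} t :: real\<bar>) \<longlonglongrightarrow> (LINT t|M. 0)"
      proof (rule integral_dominated_convergence[where w = "\<lambda>_. 2"])
        show "AE t in M. (\<lambda>n. \<bar>indicator {a<..<b} t - indicator {a' n<..<b' n} t :: real\<bar>) \<longlonglongrightarrow> 0"
        proof (intro AE_I2)
          fix t assume "t \<in> space M"
          then have t: "0 < t" "t < T" by (auto simp: space)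
          have "\<forall>\<^sub>F n in sequentially. T / (real n + 3) < t"
            using * t by (intro order_tendstoD)
          moreover have "\<forall>\<^sub>F n in sequentially. T / (real n + 3) < T - t"
            using * t by (intro order_tendstoD) auto
          ultimately have "\<forall>\<^sub>F n in sequentially. \<bar>indicator {a<..<b} t - indicator {a' n<..<b' n} t :: real\<bar> = 0"
            by eventually_elim (auto simp: a'_def b'_def split: split_indicator)
          then show "(\<lambda>n. \<bar>indicator {a<..<b} t - indicator {a' n<..<b' n} t :: real\<bar>) \<longlonglongrightarrow> 0"
            by (rule tendsto_eventually)
        qed
        show "AE t in M. norm \<bar>indicator {a<..<b} t - indicator {a' n<..<b' n} t :: real\<bar> \<le> 2" for n
          by (auto split: split_indicator)
      qed (auto intro!: borel_measurable_abs borel_measurable_diff sets_M)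
      then show "(\<lambda>n. LINT t|M. \<bar>indicator {a<..<b} t - indicator {a' n<..<b' n} t :: real\<bar>) \<longlonglongrightarrow> 0"
        by simp
    qed (auto intro: ind_int')
  next
    case False
    \<comment> \<open>The interval \<open>(0,T)\<close> is empty, so an arbitrary instance of the base case will do.\<close>
    show ?thesis
      by (rule cong[OF _ interval[of 1 "min 0 (T - 1)"]])
         (use False in \<open>auto intro!: ind_int' AE_I2 simp: space\<close>)
  qed
  have ind_empty: "(indicator {} :: real \<Rightarrow> real) = (\<lambda>t. 0)"
    by (simp add: fun_eq_iff)
  have P0: "P (\<lambda>t. 0)"
    using open_interval[of 0 0] by (simp add: ind_empty)
  have P1: "P (\<lambda>t. 1)"
    by (rule cong[OF _ open_interval[of 0 T]]) (auto intro!: AE_I2 ind_int' simp: space)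
  have sets_borel_intervals: "sets borel = sigma_sets UNIV (range (\<lambda>(a, b). {a<..<b::real}))"
    using arg_cong[OF borel_eq_box[where 'a = real], of sets] by (simp add: box_real)
  have borel: "P (indicator A)" if "A \<in> sets borel" for A :: "real set"
  proof -
    have "Int_stable (range (\<lambda>(a, b). {a<..<b::real}))"
      by (auto simp: Int_stable_def)
    moreover have "range (\<lambda>(a, b). {a<..<b::real}) \<subseteq> Pow UNIV"
      by simp
    moreover have "A \<in> sigma_sets UNIV (range (\<lambda>(a, b). {a<..<b::real}))"
      using that by (simp add: sets_borel_intervals)
    ultimately show ?thesis
    proof (induction rule: sigma_sets_induct_disjoint)
      case (basic A) then show ?case using open_interval by auto
    next
      case empty then show ?case using P0 by (simp add: ind_empty)
    next
      case (compl A)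
      then have A: "A \<in> sets lebesgue"
        by (simp add: sets_borel_intervals[symmetric])
      have "P (\<lambda>t. 1 + (-1) * indicator A t)"
        using A compl.IH P1 by (intro add scale) (auto intro: ind_int')
      moreover have "(\<lambda>t. 1 + (-1) * indicator A t) = (indicator (UNIV - A) :: real \<Rightarrow> real)"
        by (auto split: split_indicator)
      ultimately show ?case by simp
    next
      case (union A)
      have A: "A i \<in> sets lebesgue" for i
        using union(2) by (auto simp: sets_borel_intervals[symmetric])
      have fin: "P (indicator (\<Union>i<n. A i))" for n
      proof (induction n)
        case 0 then show ?case using P0 by (simp add: ind_empty)
      next
        case (Suc n)
        have "P (\<lambda>t. indicator (\<Union>i<n. A i) t + indicator (A n) t)"
          using Suc union A by (intro add) (auto intro!: ind_int')
        moreover have "A i \<inter> A n = {}" if "i < n" for i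
          using union(1) that by (intro disjoint_family_onD[OF union(1)]) auto
        then have "(\<Union>i<n. A i) \<inter> A n = {}" by blast
        then have "(\<lambda>t. indicator (\<Union>i<n. A i) t + indicator (A n) t) = (indicator ((\<Union>i<n. A i) \<union> A n) :: real \<Rightarrow> real)"
          by (auto simp: fun_eq_iff indicator_add)
        moreover have "(\<Union>i<n. A i) \<union> A n = (\<Union>i<Suc n. A i)"
          by (auto simp: lessThan_Suc)
        ultimately show ?case by simp
      qed
      show ?case
      proof (rule limit_seq[OF _ fin])
        have "(\<lambda>n. LINT t|M. \<bar>indicator (\<Union>i. A i \<inter> {0<..<T}) t - indicator (\<Union>i<n. A i \<inter> {0<..<T}) t :: real\<bar>) \<longlonglongrightarrow> 0"
          by (rule integral_indicator_UN_tendsto_0)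
             (use A in \<open>auto simp: M_def sets_restrict_space intro: finite_measure_lebesgue_on_interval\<close>)
        also have "(\<lambda>n. LINT t|M. \<bar>indicator (\<Union>i. A i \<inter> {0<..<T}) t - indicator (\<Union>i<n. A i \<inter> {0<..<T}) t :: real\<bar>) =
          (\<lambda>n. LINT t|M. \<bar>indicator (\<Union>i. A i) t - indicator (\<Union>i<n. A i) t :: real\<bar>)"
          by (intro ext Bochner_Integration.integral_cong) (auto simp: space split: split_indicator)
        finally show "(\<lambda>n. LINT t|M. \<bar>indicator (\<Union>i. A i) t - indicator (\<Union>i<n. A i) t :: real\<bar>) \<longlonglongrightarrow> 0" .
      qed (use A in \<open>auto intro!: ind_int'\<close>)
    qed
  qed
  show ?thesis
    using f
  proof (induct rule: integrable_induct)
    case (base A c)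
    have "A \<in> sets lebesgue"
      using base(1) by (auto simp: M_def sets_restrict_space)
    then obtain B N N' where B: "A = B \<union> N" "N \<subseteq> N'" "N' \<in> null_sets lborel" "B \<in> sets lborel"
      unfolding sets_completion by blast
    have N: "N \<in> null_sets lebesgue"
      using B null_sets_completionI null_sets_completion_subset by blast
    have B': "B \<in> sets borel" "B \<in> sets lebesgue" using B by auto
    have "AE t in lebesgue. indicator A t *\<^sub>R c = c * indicator B t"
      using AE_not_in[OF N] by eventually_elim (auto simp: B(1) split: split_indicator)
    then have "AE t in M. indicator A t *\<^sub>R c = c * indicator B t"
      unfolding M_def by (subst AE_restrict_space_iff) auto
    moreover have "integrable M (\<lambda>t. indicator A t *\<^sub>R c)" "integrable M (\<lambda>t. c * indicator B t)"
      using base ind_int'[OF B'(2)] by auto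
    ultimately show ?case
      using cong scale[OF ind_int'[OF B'(2)] borel[OF B'(1)], of c] by blast
  next
    case (add f g) then show ?case using assms(4) by blast
  next
    case (lim f s)
    show ?case
    proof (rule limit_seq[of f s])
      have "(\<lambda>n. LINT t|M. \<bar>f t - s n t\<bar>) \<longlonglongrightarrow> (LINT t|M. 0)"
      proof (rule integral_dominated_convergence[where w = "\<lambda>t. 3 * norm (f t)"])
        show "AE t in M. (\<lambda>n. \<bar>f t - s n t\<bar>) \<longlonglongrightarrow> 0"
        proof (intro AE_I2 tendsto_rabs_zero)
          fix t assume "t \<in> space M"
          then have "(\<lambda>n. f t - s n t) \<longlonglongrightarrow> f t - f t"
            by (intro tendsto_diff tendsto_const lim(3))
          then show "(\<lambda>n. f t - s n t) \<longlonglongrightarrow> 0" by simp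
        qed
        show "AE t in M. norm \<bar>f t - s n t\<bar> \<le> 3 * norm (f t)" for n
        proof (intro AE_I2)
          fix t assume "t \<in> space M"
          then show "norm \<bar>f t - s n t\<bar> \<le> 3 * norm (f t)" using lim(4)[of t n] by simp
        qed
      qed (use lim in auto)
      then show "(\<lambda>n. LINT t|M. \<bar>f t - s n t\<bar>) \<longlonglongrightarrow> 0" by simp
    qed (use lim in auto)
  qed
qed

lemma borel_measurable_indicator_lebesgue_on:
  "A \<in> sets lebesgue \<Longrightarrow> (indicator A :: 'a::euclidean_space \<Rightarrow> real) \<in> borel_measurable (lebesgue_on S)"
  by (intro measurable_restrict_space1 borel_measurable_indicator)

lemma restrict_lebesgue_on:
  assumes "A \<subseteq> S" "A \<in> sets lebesgue" "S \<in> sets lebesgue"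
  shows "lebesgue_on A = restrict_space (lebesgue_on S) A"
  using assms by (subst restrict_restrict_space) (auto simp: inf.absorb2)

lemma integral_lebesgue_on_subset:
  fixes f :: "'a::euclidean_space \<Rightarrow> real"
  assumes "A \<subseteq> S" "A \<in> sets lebesgue" "S \<in> sets lebesgue"
  shows "(LINT t|lebesgue_on A. f t) = (LINT t|lebesgue_on S. indicator A t * f t)"
  unfolding restrict_lebesgue_on[OF assms(1-3)]
  by (subst integral_restrict_space) (use assms in \<open>auto simp: sets_restrict_space inf.absorb1\<close>)

lemma integrable_lebesgue_on_subset:
  fixes f :: "'a::euclidean_space \<Rightarrow> real"
  assumes "A \<subseteq> S" "A \<in> sets lebesgue" "S \<in> sets lebesgue"
  shows "integrable (lebesgue_on A) f \<longleftrightarrow> integrable (lebesgue_on S) (\<lambda>t. indicator A t * f t)"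
  unfolding restrict_lebesgue_on[OF assms(1-3)]
  by (subst integrable_restrict_space) (use assms in \<open>auto simp: sets_restrict_space inf.absorb1\<close>)

lemma integrable_on_lebesgue_on_subset:
  fixes f :: "'a::euclidean_space \<Rightarrow> real"
  assumes "A \<subseteq> S" "A \<in> sets lebesgue" "S \<in> sets lebesgue" "integrable (lebesgue_on S) f"
  shows "integrable (lebesgue_on A) f"
proof -
  have "(indicator A :: 'a \<Rightarrow> real) \<in> borel_measurable (lebesgue_on S)"
    using assms(2) by (rule borel_measurable_indicator_lebesgue_on)
  then have "integrable (lebesgue_on S) (\<lambda>t. indicator A t * f t)"
    using assms(4) by (intro Bochner_Integration.integrable_bound[OF assms(4)]) (auto split: split_indicator)
  then show ?thesis using integrable_lebesgue_on_subset[OF assms(1-3)] by blast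
qed

lemma integrable_continuous_on_interval:
  assumes "continuous_on UNIV (h :: real \<Rightarrow> real)"
  shows "integrable (lebesgue_on {a<..<b}) h"
proof -
  interpret finite_measure "lebesgue_on {a<..<b}"
    by (rule finite_measure_lebesgue_on_interval)
  have "compact (h ` {a..b})"
    using assms by (intro compact_continuous_image continuous_on_subset[OF assms]) auto
  then obtain B where "\<forall>y\<in>h ` {a..b}. norm y \<le> B"
    using compact_imp_bounded bounded_iff by blast
  then show ?thesis
    using assms
    by (intro integrable_const_bound[where B = B] continuous_imp_measurable_on_sets_lebesgue)
       (auto intro: continuous_on_subset)
qed

lemma integral_derivative_interval:
  assumes "a \<le> b" "\<And>t. (f has_field_derivative h t) (at t)" "continuous_on UNIV h"
  shows "(LINT t|lebesgue_on {a<..<b}. h t) = f b - f (a::real)"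
proof -
  have "(h has_integral (f b - f a)) {a..b}"
    using assms(1,2)
    by (intro fundamental_theorem_of_calculus)
       (auto intro: has_field_derivative_at_within simp: has_real_derivative_iff_has_vector_derivative[symmetric])
  then have "integral {a<..<b} h = f b - f a"
    by (simp add: has_integral_Icc_iff_Ioo integral_unique)
  then show ?thesis
    using lebesgue_integral_eq_integral[OF integrable_continuous_on_interval[OF assms(3)], of a b] by simp
qed

text \<open>
  Indicator functions of intervals are limits of smooth bumps, and the class of functions that can
  be approximated is closed under all operations of the induction principle.
\<close>

lemma smooth_compact_support_dense:
  assumes "integrable (lebesgue_on {0<..<T}) g" "\<epsilon> > 0"
  shows "\<exists>h a b. smooth h \<and> 0 < a \<and> b < T \<and> (\<forall>t. t \<notin> {a<..<b} \<longrightarrow> h t = 0) \<and>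
    (LINT t|lebesgue_on {0<..<T}. \<bar>g t - h t\<bar>) < \<epsilon>"
  using assms
proof (induction g arbitrary: \<epsilon> rule: L1_interval_induct)
  case (interval a b)
  interpret finite_measure "lebesgue_on {0<..<T}"
    by (rule finite_measure_lebesgue_on_interval)
  obtain h where h: "\<And>m::nat. smooth (h m)" "\<And>m t. h m t \<in> {0..1}" "\<And>m t. t \<notin> {a<..<b} \<Longrightarrow> h m t = 0"
    "\<And>t. (\<lambda>m. h m t) \<longlonglongrightarrow> indicator {a<..<b} t"
    using smooth_approx_indicator[of a b] by blast
  have meas: "h m \<in> borel_measurable (lebesgue_on {0<..<T})" for m
    by (intro continuous_imp_measurable_on_sets_lebesgue smooth_continuous_on h) auto
  have ind: "(indicator {a<..<b} :: real \<Rightarrow> real) \<in> borel_measurable (lebesgue_on {0<..<T})"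
    by (rule borel_measurable_indicator_lebesgue_on) simp
  have "(\<lambda>m. LINT t|lebesgue_on {0<..<T}. \<bar>indicator {a<..<b} t - h m t\<bar>) \<longlonglongrightarrow> (LINT t|lebesgue_on {0<..<T}. 0)"
  proof (rule integral_dominated_convergence[where w = "\<lambda>_. 2"])
    show "AE t in lebesgue_on {0<..<T}. (\<lambda>m. \<bar>indicator {a<..<b} t - h m t\<bar>) \<longlonglongrightarrow> 0"
    proof (intro AE_I2 tendsto_rabs_zero)
      fix t
      show "(\<lambda>m. indicator {a<..<b} t - h m t) \<longlonglongrightarrow> 0"
        using tendsto_diff[OF tendsto_const h(4)[of t], of "indicator {a<..<b} t"] by simp
    qed
    show "AE t in lebesgue_on {0<..<T}. norm \<bar>indicator {a<..<b} t - h m t\<bar> \<le> 2" for m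
    proof (intro AE_I2)
      fix t
      show "norm \<bar>indicator {a<..<b} t - h m t\<bar> \<le> 2"
        using h(2)[of m t] by (auto split: split_indicator)
    qed
  qed (use meas ind in auto)
  then have "(\<lambda>m. LINT t|lebesgue_on {0<..<T}. \<bar>indicator {a<..<b} t - h m t\<bar>) \<longlonglongrightarrow> 0" by simp
  then have "\<forall>\<^sub>F m in sequentially. (LINT t|lebesgue_on {0<..<T}. \<bar>indicator {a<..<b} t - h m t\<bar>) < \<epsilon>"
    using interval(3) by (rule order_tendstoD)
  then obtain m where "(LINT t|lebesgue_on {0<..<T}. \<bar>indicator {a<..<b} t - h m t\<bar>) < \<epsilon>"
    by (auto simp: eventually_sequentially)
  then show ?case using h interval by blast
next
  case (add f g)
  obtain h a b where h: "smooth h" "0 < a" "b < T" "\<forall>t. t \<notin> {a<..<b} \<longrightarrow> h t = 0"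
    "(LINT t|lebesgue_on {0<..<T}. \<bar>f t - h t\<bar>) < \<epsilon> / 2"
    using add.IH(1)[of "\<epsilon> / 2"] add.prems by auto
  obtain h' a' b' where h': "smooth h'" "0 < a'" "b' < T" "\<forall>t. t \<notin> {a'<..<b'} \<longrightarrow> h' t = 0"
    "(LINT t|lebesgue_on {0<..<T}. \<bar>g t - h' t\<bar>) < \<epsilon> / 2"
    using add.IH(2)[of "\<epsilon> / 2"] add.prems by auto
  have int: "integrable (lebesgue_on {0<..<T}) h" "integrable (lebesgue_on {0<..<T}) h'"
    using h(1) h'(1) by (auto intro: integrable_continuous_on_interval smooth_continuous_on)
  have "(LINT t|lebesgue_on {0<..<T}. \<bar>f t + g t - (h t + h' t)\<bar>)
      \<le> (LINT t|lebesgue_on {0<..<T}. \<bar>f t - h t\<bar> + \<bar>g t - h' t\<bar>)"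
    using int add.hyps by (intro integral_mono) auto
  also have "\<dots> < \<epsilon>"
    using int add.hyps h(5) h'(5) by (subst Bochner_Integration.integral_add) auto
  finally have "(LINT t|lebesgue_on {0<..<T}. \<bar>f t + g t - (h t + h' t)\<bar>) < \<epsilon>" .
  moreover have "h t + h' t = 0" if "t \<notin> {min a a'<..<max b b'}" for t
  proof -
    have "t \<notin> {a<..<b}" "t \<notin> {a'<..<b'}" using that by auto
    then have "h t = 0" "h' t = 0" using h(4) h'(4) by blast+
    then show ?thesis by simp
  qed
  moreover have "0 < min a a'" "max b b' < T" using h h' by auto
  ultimately show ?case using smooth_add[OF h(1) h'(1)] by blast
next
  case (scale c f)
  obtain h a b where h: "smooth h" "0 < a" "b < T" "\<forall>t. t \<notin> {a<..<b} \<longrightarrow> h t = 0"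
    "(LINT t|lebesgue_on {0<..<T}. \<bar>f t - h t\<bar>) < \<epsilon> / (\<bar>c\<bar> + 1)"
    using scale.IH[of "\<epsilon> / (\<bar>c\<bar> + 1)"] scale.prems by auto
  have nonneg: "0 \<le> (LINT t|lebesgue_on {0<..<T}. \<bar>f t - h t\<bar>)" by simp
  have "(LINT t|lebesgue_on {0<..<T}. \<bar>c * f t - c * h t\<bar>) = \<bar>c\<bar> * (LINT t|lebesgue_on {0<..<T}. \<bar>f t - h t\<bar>)"
    by (simp add: right_diff_distrib[symmetric] abs_mult)
  also have "\<dots> \<le> (\<bar>c\<bar> + 1) * (LINT t|lebesgue_on {0<..<T}. \<bar>f t - h t\<bar>)"
    using nonneg by (intro mult_right_mono) auto
  also have "\<dots> < \<epsilon>" using h(5) by (simp add: field_simps)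
  finally have "(LINT t|lebesgue_on {0<..<T}. \<bar>c * f t - c * h t\<bar>) < \<epsilon>" .
  moreover have "\<forall>t. t \<notin> {a<..<b} \<longrightarrow> c * h t = 0" using h(4) by auto
  ultimately show ?case using h(2,3) smooth_mult[OF smooth_const h(1), of c] by blast
next
  case (limit f)
  obtain g where g: "integrable (lebesgue_on {0<..<T}) g"
    "\<And>\<epsilon>. \<epsilon> > 0 \<Longrightarrow> \<exists>h a b. smooth h \<and> 0 < a \<and> b < T \<and> (\<forall>t. t \<notin> {a<..<b} \<longrightarrow> h t = 0) \<and>
    (LINT t|lebesgue_on {0<..<T}. \<bar>g t - h t\<bar>) < \<epsilon>"
    "(LINT t|lebesgue_on {0<..<T}. \<bar>f t - g t\<bar>) < \<epsilon> / 2"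
    using limit.IH[of "\<epsilon> / 2"] limit.prems by auto
  obtain h a b where h: "smooth h" "0 < a" "b < T" "\<forall>t. t \<notin> {a<..<b} \<longrightarrow> h t = 0"
    "(LINT t|lebesgue_on {0<..<T}. \<bar>g t - h t\<bar>) < \<epsilon> / 2"
    using g(2)[of "\<epsilon> / 2"] limit.prems by auto
  have int: "integrable (lebesgue_on {0<..<T}) h"
    using h(1) by (auto intro: integrable_continuous_on_interval smooth_continuous_on)
  have "(LINT t|lebesgue_on {0<..<T}. \<bar>f t - h t\<bar>)
      \<le> (LINT t|lebesgue_on {0<..<T}. \<bar>f t - g t\<bar> + \<bar>g t - h t\<bar>)"
    using int g limit.hyps by (intro integral_mono) auto
  also have "\<dots> < \<epsilon>"
    using int limit.hyps g h by (subst Bochner_Integration.integral_add) auto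
  finally show ?case using h by blast
qed

section \<open>Integration by parts against a function of bounded variation\<close>

lemma test_functions_altdef:
  "test_functions T = {\<phi>. smooth \<phi> \<and> closure {t. \<phi> t \<noteq> 0} \<subseteq> {0<..<T}}"
  by (simp add: test_functions_def smooth_def)

text \<open>
  A smooth compactly supported function is the derivative of a test function iff its integral
  vanishes.  An approximation \<open>h\<close> of \<open>g\<close> has a small integral, which is removed by subtracting a small
  multiple of a fixed bump \<open>\<beta>\<close>.
\<close>

lemma test_function_derivatives_dense:
  assumes T: "T > 0" and g: "integrable (lebesgue_on {0<..<T}) g" "(LINT t|lebesgue_on {0<..<T}. g t) = 0"
    and "\<epsilon> > 0"
  shows "\<exists>\<psi>\<in>test_functions T. (LINT t|lebesgue_on {0<..<T}. \<bar>g t - deriv \<psi> t\<bar>) < \<epsilon>"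
proof -
  let ?M = "lebesgue_on {0<..<T}"
  have smooth_int: "integrable ?M h" if "smooth h" for h
    using that by (auto intro: integrable_continuous_on_interval smooth_continuous_on)
  have const: "integrable ?M (\<lambda>t. 1 :: real)" "(LINT t|?M. 1 :: real) = T"
    using T by (auto intro: integrable_continuous_on_interval simp: measure_restrict_space)
  \<comment> \<open>A smooth compactly supported \<open>\<beta>\<close> within distance \<open>T\<close> of the constant \<open>1\<close> has positive integral.\<close>
  obtain \<beta> a' b' where \<beta>: "smooth \<beta>" "0 < a'" "b' < T" "\<forall>t. t \<notin> {a'<..<b'} \<longrightarrow> \<beta> t = 0"
    "(LINT t|?M. \<bar>1 - \<beta> t\<bar>) < T"
    using smooth_compact_support_dense[OF const(1) T] by blast
  define \<kappa> where "\<kappa> = (LINT t|?M. \<beta> t)"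
  have "T - \<kappa> = (LINT t|?M. 1 - \<beta> t)"
    unfolding \<kappa>_def using const smooth_int[OF \<beta>(1)] by simp
  also have "\<dots> \<le> (LINT t|?M. \<bar>1 - \<beta> t\<bar>)"
    using const smooth_int[OF \<beta>(1)] by (intro integral_mono) auto
  finally have \<kappa>: "\<kappa> > 0" using \<beta>(5) by simp
  \<comment> \<open>The correction costs at most \<open>K\<close> times the error of \<open>h\<close>, hence the tolerance \<open>\<epsilon> / (1 + K)\<close> below.\<close>
  define K where "K = (LINT t|?M. \<bar>\<beta> t\<bar>) / \<kappa>"
  have K: "K \<ge> 0" unfolding K_def using \<kappa> by simp
  obtain h a b where h: "smooth h" "0 < a" "b < T" "\<forall>t. t \<notin> {a<..<b} \<longrightarrow> h t = 0"
    "(LINT t|?M. \<bar>g t - h t\<bar>) < \<epsilon> / (1 + K)"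
    using smooth_compact_support_dense[OF g(1), of "\<epsilon> / (1 + K)"] K \<open>\<epsilon> > 0\<close> by (auto simp: add_pos_nonneg)
  define c where "c = (LINT t|?M. h t) / \<kappa>"
  define H where "H t = h t + (- c) * \<beta> t" for t
  have H: "smooth H" unfolding H_def using h \<beta> by (intro smooth_add smooth_mult smooth_const)
  have H0: "(LINT t|?M. H t) = 0"
    unfolding H_def using smooth_int[OF h(1)] smooth_int[OF \<beta>(1)] \<kappa>
    by (simp add: c_def \<kappa>_def[symmetric])
  have "\<bar>LINT t|?M. h t\<bar> = \<bar>LINT t|?M. g t - h t\<bar>"
    using smooth_int[OF h(1)] g by simp
  also have "\<dots> \<le> (LINT t|?M. \<bar>g t - h t\<bar>)" by (rule integral_abs_bound)
  finally have "\<bar>c\<bar> \<le> (LINT t|?M. \<bar>g t - h t\<bar>) / \<kappa>"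
    unfolding c_def using \<kappa> by (simp add: divide_right_mono)
  then have c: "\<bar>c\<bar> * (LINT t|?M. \<bar>\<beta> t\<bar>) \<le> (LINT t|?M. \<bar>g t - h t\<bar>) / \<kappa> * (LINT t|?M. \<bar>\<beta> t\<bar>)"
    by (rule mult_right_mono) simp
  have "(LINT t|?M. \<bar>g t - H t\<bar>) \<le> (LINT t|?M. \<bar>g t - h t\<bar> + \<bar>c\<bar> * \<bar>\<beta> t\<bar>)"
    unfolding H_def using smooth_int[OF h(1)] smooth_int[OF \<beta>(1)] g
    by (intro integral_mono) (auto simp: abs_mult[symmetric])
  also have "\<dots> = (LINT t|?M. \<bar>g t - h t\<bar>) + \<bar>c\<bar> * (LINT t|?M. \<bar>\<beta> t\<bar>)"
    using smooth_int[OF h(1)] smooth_int[OF \<beta>(1)] g by (subst Bochner_Integration.integral_add) auto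
  also have "\<dots> \<le> (LINT t|?M. \<bar>g t - h t\<bar>) * (1 + K)"
    using c by (simp add: K_def algebra_simps)
  also have "\<dots> < \<epsilon>" using h(5) K by (simp add: field_simps add_pos_nonneg)
  finally have approx: "(LINT t|?M. \<bar>g t - H t\<bar>) < \<epsilon>" .
  have "isCont H t" for t using DERIV_isCont[OF smooth_imp_deriv[OF H]] .
  then obtain F where F: "\<And>t. (F has_field_derivative H t) (at t)"
    using einterval_antiderivative[of "-\<infinity>" \<infinity> H]
    by (auto simp: has_real_derivative_iff_has_vector_derivative)
  define \<psi> where "\<psi> t = F t - F 0" for t
  have \<psi>: "(\<psi> has_field_derivative H t) (at t)" for t
    unfolding \<psi>_def using F[of t] by (auto intro!: derivative_eq_intros)
  have supp: "H t = 0" if "t \<notin> {min a a'<..<max b b'}" for t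
  proof -
    have "t \<notin> {a<..<b}" "t \<notin> {a'<..<b'}" using that by auto
    then have "h t = 0" "\<beta> t = 0" using h(4) \<beta>(4) by blast+
    then show ?thesis by (simp add: H_def)
  qed
  have "\<exists>c. \<forall>t\<in>{..min a a'}. \<psi> t = c"
    by (rule has_field_derivative_zero_constant)
       (use supp has_field_derivative_at_within[OF \<psi>] in \<open>auto simp: not_less[symmetric] intro: DERIV_cong\<close>)
  then obtain c1 where "\<forall>t\<in>{..min a a'}. \<psi> t = c1" by blast
  moreover have "\<psi> 0 = 0" "0 \<in> {..min a a'}" using h \<beta> by (auto simp: \<psi>_def)
  ultimately have left: "\<psi> t = 0" if "t \<le> min a a'" for t using that by force
  have "\<exists>c. \<forall>t\<in>{max b b'..}. \<psi> t = c"
    by (rule has_field_derivative_zero_constant)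
       (use supp has_field_derivative_at_within[OF \<psi>] in \<open>auto simp: not_less[symmetric] intro: DERIV_cong\<close>)
  then obtain c2 where "\<forall>t\<in>{max b b'..}. \<psi> t = c2" by blast
  moreover have "\<psi> T = 0"
    using integral_derivative_interval[OF less_imp_le[OF T] \<psi> smooth_continuous_on[OF H]] H0
    by (simp add: \<psi>_def)
  moreover have "T \<in> {max b b'..}" using h \<beta> by auto
  ultimately have right: "\<psi> t = 0" if "t \<ge> max b b'" for t using that by force
  have "{t. \<psi> t \<noteq> 0} \<subseteq> {min a a'..max b b'}"
    using left right by (force simp: not_le)
  then have "closure {t. \<psi> t \<noteq> 0} \<subseteq> {min a a'..max b b'}"
    by (rule closure_minimal) simp
  also have "\<dots> \<subseteq> {0<..<T}" using h \<beta> by auto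
  finally have "\<psi> \<in> test_functions T"
    using smooth_antiderivative[OF H \<psi>] by (simp add: test_functions_altdef)
  moreover have "deriv \<psi> = H" using DERIV_imp_deriv[OF \<psi>] by blast
  ultimately show ?thesis using approx by (intro bexI[of _ \<psi>]) auto
qed

lemma zero_in_test_functions: "(\<lambda>t. 0) \<in> test_functions T"
  by (simp add: test_functions_altdef smooth_const)

lemma distributional_deriv_zero: "distributional_deriv T f (\<lambda>t. 0) = 0"
  by (simp add: distributional_deriv_def)

lemma test_functions_scale:
  assumes "\<phi> \<in> test_functions T"
  shows "(\<lambda>t. c * \<phi> t) \<in> test_functions T"
proof -
  have "{t. c * \<phi> t \<noteq> 0} \<subseteq> {t. \<phi> t \<noteq> 0}" by auto
  from closure_mono[OF this] show ?thesis
    using assms smooth_mult[OF smooth_const] by (auto simp: test_functions_altdef)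
qed

lemma distributional_deriv_scale:
  assumes "\<phi> \<in> test_functions T"
  shows "distributional_deriv T f (\<lambda>t. c * \<phi> t) = c * distributional_deriv T f \<phi>"
proof -
  have "smooth \<phi>" using assms by (simp add: test_functions_altdef)
  then have "deriv (\<lambda>t. c * \<phi> t) t = c * deriv \<phi> t" for t
    by (intro DERIV_imp_deriv DERIV_cmult smooth_imp_deriv)
  then show ?thesis by (simp add: distributional_deriv_def mult.left_commute)
qed

text \<open>
  Formally \<open>\<integral>f g = - \<integral>G df\<close> with the primitive \<open>G\<close> of \<open>g\<close>, which vanishes at both ends and is
  bounded by \<open>m\<close>.  A test function \<open>\<psi>\<close> whose derivative is within \<open>\<epsilon>\<close> of \<open>g\<close> in \<open>L\<^sup>1\<close> is within \<open>\<epsilon>\<close> of \<open>G\<close>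
  uniformly, so \<open>\<psi> / (m + \<epsilon>)\<close> is admissible in the definition of the total variation.
\<close>

theorem BV_duality_primitive:
  assumes T: "T > 0"
    and f: "f \<in> borel_measurable (lebesgue_on {0<..<T})" "AE t in lebesgue_on {0<..<T}. \<bar>f t\<bar> \<le> 1"
    and TV: "\<And>\<phi>. \<phi> \<in> test_functions T \<Longrightarrow> (\<And>t. \<bar>\<phi> t\<bar> \<le> 1) \<Longrightarrow> distributional_deriv T f \<phi> \<le> C"
    and g: "integrable (lebesgue_on {0<..<T}) g" "(LINT t|lebesgue_on {0<..<T}. g t) = 0"
    and primitive: "\<And>t. t \<in> {0<..<T} \<Longrightarrow> \<bar>LINT s|lebesgue_on {0<..<t}. g s\<bar> \<le> m"
  shows "\<bar>LINT t|lebesgue_on {0<..<T}. f t * g t\<bar> \<le> m * C"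
proof -
  let ?M = "lebesgue_on {0<..<T}"
  have C: "C \<ge> 0"
    using TV[OF zero_in_test_functions] by (simp add: distributional_deriv_zero)
  have m: "m \<ge> 0" using primitive[of "T / 2"] T by (simp add: order_trans[OF abs_ge_zero])
  have est: "\<bar>LINT t|?M. f t * g t\<bar> \<le> (m + \<epsilon>) * C + \<epsilon>" if "\<epsilon> > 0" for \<epsilon>
  proof -
    obtain \<psi> where \<psi>: "\<psi> \<in> test_functions T" "(LINT t|?M. \<bar>g t - deriv \<psi> t\<bar>) < \<epsilon>"
      using test_function_derivatives_dense[OF T g \<open>\<epsilon> > 0\<close>] by blast
    have "smooth \<psi>" and supp: "{t. \<psi> t \<noteq> 0} \<subseteq> {0<..<T}"
      using \<psi>(1) closure_subset[of "{t. \<psi> t \<noteq> 0}"] by (auto simp: test_functions_altdef)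
    note D = smooth_imp_deriv[OF \<open>smooth \<psi>\<close>]
    note cont = smooth_continuous_on[OF smooth_deriv[OF \<open>smooth \<psi>\<close>]]
    have int: "integrable ?M (deriv \<psi>)" by (intro integrable_continuous_on_interval cont)
    have \<psi>_bound: "\<bar>\<psi> t\<bar> \<le> m + \<epsilon>" for t
    proof (cases "t \<in> {0<..<T}")
      case True
      have sub: "{0<..<t} \<subseteq> {0<..<T}" using True by auto
      have g_t: "integrable (lebesgue_on {0<..<t}) g"
        using integrable_on_lebesgue_on_subset[OF sub _ _ g(1)] by simp
      have d_t: "integrable (lebesgue_on {0<..<t}) (deriv \<psi>)"
        by (intro integrable_continuous_on_interval cont)
      have "\<psi> 0 = 0" using supp by force
      then have "\<psi> t = (LINT s|lebesgue_on {0<..<t}. deriv \<psi> s)"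
        using integral_derivative_interval[OF _ D cont, of 0 t] True by auto
      then have "(LINT s|lebesgue_on {0<..<t}. g s) - \<psi> t = (LINT s|lebesgue_on {0<..<t}. g s - deriv \<psi> s)"
        using g_t d_t by simp
      also have "\<bar>\<dots>\<bar> \<le> (LINT s|lebesgue_on {0<..<t}. \<bar>g s - deriv \<psi> s\<bar>)"
        by (rule integral_abs_bound)
      also have "\<dots> = (LINT s|?M. indicator {0<..<t} s * \<bar>g s - deriv \<psi> s\<bar>)"
        by (intro integral_lebesgue_on_subset sub) auto
      also have "\<dots> \<le> (LINT s|?M. \<bar>g s - deriv \<psi> s\<bar>)"
        using g(1) int integrable_lebesgue_on_subset[OF sub, of "\<lambda>s. \<bar>g s - deriv \<psi> s\<bar>"] g_t d_t
        by (intro integral_mono) (auto split: split_indicator)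
      finally show ?thesis using primitive[OF True] \<psi>(2) by linarith
    next
      case False
      then have "\<psi> t = 0" using supp by blast
      then show ?thesis using m \<open>\<epsilon> > 0\<close> by simp
    qed
    have pos: "m + \<epsilon> > 0" using m \<open>\<epsilon> > 0\<close> by simp
    have "c * distributional_deriv T f \<psi> \<le> C" if c: "\<bar>c\<bar> = 1 / (m + \<epsilon>)" for c
      unfolding distributional_deriv_scale[OF \<psi>(1), symmetric]
    proof (intro TV test_functions_scale \<psi>(1))
      show "\<bar>c * \<psi> t\<bar> \<le> 1" for t
        using \<psi>_bound[of t] pos by (simp add: abs_mult c)
    qed
    \<comment> \<open>Both signs of \<open>\<psi>\<close> are admissible.\<close>
    from this[of "1 / (m + \<epsilon>)"] this[of "- (1 / (m + \<epsilon>))"]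
    have *: "\<bar>distributional_deriv T f \<psi>\<bar> \<le> (m + \<epsilon>) * C"
      using pos by (auto simp: field_simps abs_le_iff)
    have bound: "AE t in ?M. norm (f t * u t) \<le> norm (u t)" for u :: "real \<Rightarrow> real"
      using f(2) by eventually_elim (simp add: abs_mult mult_left_le_one_le)
    have f_int: "integrable ?M (\<lambda>t. f t * u t)" if "integrable ?M u" for u
      by (rule Bochner_Integration.integrable_bound[OF that _ bound]) (use that f in auto)
    have "(LINT t|?M. f t * g t) + distributional_deriv T f \<psi> = (LINT t|?M. f t * (g t - deriv \<psi> t))"
      using f_int[OF g(1)] f_int[OF int] by (simp add: distributional_deriv_def right_diff_distrib)
    also have "\<bar>\<dots>\<bar> \<le> (LINT t|?M. \<bar>f t * (g t - deriv \<psi> t)\<bar>)" by (rule integral_abs_bound)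
    also have "\<dots> \<le> (LINT t|?M. \<bar>g t - deriv \<psi> t\<bar>)"
      using f_int[of "\<lambda>t. g t - deriv \<psi> t"] g(1) int bound[of "\<lambda>t. g t - deriv \<psi> t"]
      by (intro integral_mono_AE) auto
    finally show ?thesis using * \<psi>(2) by linarith
  qed
  show ?thesis
  proof (rule field_le_epsilon)
    fix \<epsilon> :: real assume "\<epsilon> > 0"
    then have "\<bar>LINT t|?M. f t * g t\<bar> \<le> (m + \<epsilon> / (C + 1)) * C + \<epsilon> / (C + 1)"
      using C by (intro est) auto
    also have "\<dots> = m * C + \<epsilon> / (C + 1) * (C + 1)"
      by (simp only: distrib_left distrib_right mult_1_right add.assoc)
    also have "\<dots> = m * C + \<epsilon>" using C by simp
    finally show "\<bar>LINT t|?M. f t * g t\<bar> \<le> m * C + \<epsilon>" .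
  qed
qed

section \<open>Functions oscillating on a partition\<close>

lemma integrable_mult_bounded:
  fixes v g :: "'a \<Rightarrow> real"
  assumes "integrable M v" "g \<in> borel_measurable M" "\<And>t. \<bar>g t\<bar> \<le> B"
  shows "integrable M (\<lambda>t. v t * g t)"
proof (rule Bochner_Integration.integrable_bound[of M "\<lambda>t. v t * B"])
  show "AE t in M. norm (v t * g t) \<le> norm (v t * B)"
  proof (rule AE_I2)
    fix t
    have "\<bar>v t\<bar> * \<bar>g t\<bar> \<le> \<bar>v t\<bar> * \<bar>B\<bar>"
      using assms(3)[of t] by (intro mult_left_mono) auto
    then show "norm (v t * g t) \<le> norm (v t * B)" by (simp add: abs_mult)
  qed
qed (use assms in auto)

text \<open>
  Testing against the indicator function of an interval gives a difference of two values of the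
  primitive; the general case follows by density, as the functions are uniformly bounded.
\<close>

lemma weak_convergence_of_primitives:
  fixes g :: "nat \<Rightarrow> real \<Rightarrow> real"
  assumes "integrable (lebesgue_on {0<..<T}) v"
    and g: "\<And>k. g k \<in> borel_measurable (lebesgue_on {0<..<T})" "\<And>k t. \<bar>g k t\<bar> \<le> B"
    and primitive: "\<And>k t. t \<in> {0<..<T} \<Longrightarrow> \<bar>LINT s|lebesgue_on {0<..<t}. g k s\<bar> \<le> m k"
    and m: "m \<longlonglongrightarrow> 0"
  shows "(\<lambda>k. LINT t|lebesgue_on {0<..<T}. v t * g k t) \<longlonglongrightarrow> 0"
  using assms(1)
proof (induction v rule: L1_interval_induct)
  case (interval a b)
  interpret finite_measure "lebesgue_on {0<..<T}"
    by (rule finite_measure_lebesgue_on_interval)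
  have int: "integrable (lebesgue_on {0<..<T}) (\<lambda>t. indicator A t * g k t)" if "A \<in> sets lebesgue" for k A
    using g(2)[of k] order_trans[OF abs_ge_zero g(2)] borel_measurable_indicator_lebesgue_on[OF that] g(1)[of k]
    by (intro integrable_const_bound[where B = B]) (auto simp: abs_mult split: split_indicator)
  show ?case
  proof (cases "a < b")
    case True
    have bound: "\<bar>LINT t|lebesgue_on {0<..<T}. indicator {a<..<b} t * g k t\<bar> \<le> 2 * m k" for k
    proof -
      have "AE t in lebesgue. t \<noteq> a" by (intro AE_completion AE_lborel_singleton)
      then have "AE t in lebesgue_on {0<..<T}. t \<noteq> a"
        by (subst AE_restrict_space_iff) (auto elim!: eventually_mono)
      then have "(LINT t|lebesgue_on {0<..<T}. indicator {a<..<b} t * g k t)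
        = (LINT t|lebesgue_on {0<..<T}. indicator {0<..<b} t * g k t - indicator {0<..<a} t * g k t)"
        using int g True interval
        by (intro integral_cong_AE borel_measurable_integrable Bochner_Integration.integrable_diff)
           (auto split: split_indicator elim!: eventually_mono)
      also have "\<dots> = (LINT t|lebesgue_on {0<..<b}. g k t) - (LINT t|lebesgue_on {0<..<a}. g k t)"
      proof -
        have "{0<..<a} \<subseteq> {0<..<T}" "{0<..<b} \<subseteq> {0<..<T}" using interval True by auto
        then show ?thesis
          using int integral_lebesgue_on_subset[of "{0<..<a}" "{0<..<T}" "g k"]
            integral_lebesgue_on_subset[of "{0<..<b}" "{0<..<T}" "g k"] by simp
      qed
      also have "\<bar>\<dots>\<bar> \<le> m k + m k"
        using primitive[of a k] primitive[of b k] interval True by auto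
      finally show ?thesis by simp
    qed
    have "(\<lambda>k. 2 * m k) \<longlonglongrightarrow> 0" using tendsto_mult_right_zero[OF m] by simp
    then show ?thesis
      by (rule Lim_null_comparison[rotated]) (simp add: bound)
  qed simp
next
  case (add v w)
  note int = integrable_mult_bounded[OF _ g]
  show ?case
    using tendsto_add[OF add.IH] int[OF add.hyps(1)] int[OF add.hyps(2)] by (simp add: distrib_right)
next
  case (scale c v)
  then show ?case using tendsto_mult_right_zero[OF scale.IH, of c] by (simp add: mult.assoc)
next
  case (limit v)
  have B: "B \<ge> 0" using order_trans[OF abs_ge_zero g(2)] .
  note int = integrable_mult_bounded[OF _ g]
  show ?case
  proof (rule LIMSEQ_I)
    fix r :: real assume r: "r > 0"
    then obtain w where w: "integrable (lebesgue_on {0<..<T}) w"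
      "(\<lambda>k. LINT t|lebesgue_on {0<..<T}. w t * g k t) \<longlonglongrightarrow> 0"
      "(LINT t|lebesgue_on {0<..<T}. \<bar>v t - w t\<bar>) < r / (2 * (B + 1))"
      using limit.IH[of "r / (2 * (B + 1))"] B by auto
    obtain K where K: "\<And>k. k \<ge> K \<Longrightarrow> \<bar>LINT t|lebesgue_on {0<..<T}. w t * g k t\<bar> < r / 2"
      using LIMSEQ_D[OF w(2), of "r / 2"] r by auto
    have "norm ((LINT t|lebesgue_on {0<..<T}. v t * g k t) - 0) < r" if "k \<ge> K" for k
    proof -
      have "(LINT t|lebesgue_on {0<..<T}. v t * g k t) - (LINT t|lebesgue_on {0<..<T}. w t * g k t)
        = (LINT t|lebesgue_on {0<..<T}. (v t - w t) * g k t)"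
        using int[OF limit.hyps] int[OF w(1)] by (simp add: left_diff_distrib)
      also have "\<bar>\<dots>\<bar> \<le> (LINT t|lebesgue_on {0<..<T}. \<bar>(v t - w t) * g k t\<bar>)"
        by (rule integral_abs_bound)
      also have "\<dots> \<le> (LINT t|lebesgue_on {0<..<T}. \<bar>v t - w t\<bar> * B)"
      proof (rule integral_mono)
        show "integrable (lebesgue_on {0<..<T}) (\<lambda>t. \<bar>(v t - w t) * g k t\<bar>)"
          using limit.hyps w(1) by (intro integrable_abs int Bochner_Integration.integrable_diff)
        show "\<bar>(v t - w t) * g k t\<bar> \<le> \<bar>v t - w t\<bar> * B" for t
          using g(2)[of k t] by (simp add: abs_mult mult_left_mono)
      qed (use limit.hyps w(1) in auto)
      also have "\<dots> \<le> (LINT t|lebesgue_on {0<..<T}. \<bar>v t - w t\<bar>) * (B + 1)"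
        by (simp add: distrib_left)
      also have "\<dots> < r / 2" using w(3) B by (simp add: field_simps)
      finally have "\<bar>(LINT t|lebesgue_on {0<..<T}. v t * g k t) - (LINT t|lebesgue_on {0<..<T}. w t * g k t)\<bar> < r / 2" .
      then show ?thesis using K[OF that] unfolding real_norm_def by linarith
    qed
    then show "\<exists>no. \<forall>k\<ge>no. norm ((LINT t|lebesgue_on {0<..<T}. v t * g k t) - 0) < r" by blast
  qed
qed

locale interval_partition =
  fixes T :: real and N :: nat and I :: "nat \<Rightarrow> real set"
  assumes T: "T > 0"
    and cell: "\<And>i. i \<in> {1..N} \<Longrightarrow> I i \<noteq> {} \<and> open (I i) \<and> is_interval (I i) \<and> I i \<subseteq> {0<..<T}"
    and disjoint: "disjoint_family_on I {1..N}"
    and cover: "(\<Union>i\<in>{1..N}. closure (I i)) = {0..T}"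
begin

abbreviation "M \<equiv> lebesgue_on {0<..<T}"

definition mesh :: real
  where "mesh = Max ((\<lambda>i. measure lebesgue (I i)) ` {1..N})"

sublocale finite_measure M
  by (rule finite_measure_lebesgue_on_interval)

lemma cell_lmeasurable: "i \<in> {1..N} \<Longrightarrow> I i \<in> lmeasurable"
  using cell[of i] bounded_subset[OF bounded_box[of 0 T]] by (intro lmeasurable_open) (auto simp: box_real)

lemma cell_sets: "i \<in> {1..N} \<Longrightarrow> I i \<in> sets lebesgue"
  using cell_lmeasurable by (rule fmeasurableD)

lemma cell_measure_pos:
  assumes i: "i \<in> {1..N}"
  shows "measure lebesgue (I i) > 0"
proof -
  have "\<not> negligible (I i)" using cell[OF i] open_not_negligible by blast
  then have "measure lebesgue (I i) \<noteq> 0"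
    using cell_lmeasurable[OF i] by (auto simp: negligible_iff_measure)
  then show ?thesis by (simp add: zero_less_measure_iff)
qed

lemma cell_measure_le_mesh: "i \<in> {1..N} \<Longrightarrow> measure lebesgue (I i) \<le> mesh"
  by (auto simp: mesh_def intro!: Max_ge)

lemma mesh_nonneg: "mesh \<ge> 0"
proof -
  have "{1..N} \<noteq> {}" using cover T by force
  then obtain i where "i \<in> {1..N}" by blast
  then show ?thesis using cell_measure_le_mesh[of i] measure_nonneg[of lebesgue "I i"] by linarith
qed

lemma measure_M_cell: "i \<in> {1..N} \<Longrightarrow> measure M (I i) = measure lebesgue (I i)"
  using cell[of i] by (subst measure_restrict_space) auto

lemma cell_in_M: "i \<in> {1..N} \<Longrightarrow> I i \<in> sets M"
  using cell[of i] cell_sets[of i] by (auto simp: sets_restrict_space)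

lemma cell_integral:
  fixes f :: "real \<Rightarrow> real"
  assumes "i \<in> {1..N}"
  shows "(LINT t|lebesgue_on (I i). f t) = (LINT t|M. indicator (I i) t * f t)"
  using cell[OF assms] cell_sets[OF assms] by (intro integral_lebesgue_on_subset) auto

lemma indicator_measurable: "i \<in> {1..N} \<Longrightarrow> (indicator (I i) :: real \<Rightarrow> real) \<in> borel_measurable M"
  by (intro borel_measurable_indicator_lebesgue_on cell_sets)

lemma integrable_indicator_mult:
  assumes "i \<in> {1..N}" "integrable M f"
  shows "integrable M (\<lambda>t. indicator (I i) t * f t :: real)"
  using indicator_measurable[OF assms(1)] assms(2)
  by (intro Bochner_Integration.integrable_bound[OF assms(2)]) (auto split: split_indicator)

lemma sum_indicator_cells:
  assumes "t \<in> I i" "i \<in> {1..N}"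
  shows "(\<Sum>l\<in>{1..N}. indicator (I l) t * c l) = (c i :: real)"
proof -
  have "indicator (I l) t * c l = (if l = i then c i else 0)" if "l \<in> {1..N}" for l
    using disjoint_family_onD[OF disjoint that assms(2)] assms(1) by (auto split: split_indicator)
  then have "(\<Sum>l\<in>{1..N}. indicator (I l) t * c l) = (\<Sum>l\<in>{1..N}. if l = i then c i else 0)"
    by (intro sum.cong) auto
  then show ?thesis using assms(2) by simp
qed

text \<open>
  The frontier of a convex set is negligible, and the closures of the cells cover the interval.
\<close>

lemma AE_in_cell: "AE t in M. \<exists>i\<in>{1..N}. t \<in> I i"
proof -
  have "negligible (\<Union>i\<in>{1..N}. frontier (I i))"
  proof (rule negligible_Union)
    show "negligible X" if "X \<in> (\<lambda>i. frontier (I i)) ` {1..N}" for X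
      using that cell by (elim imageE) (simp add: negligible_convex_frontier is_interval_convex)
  qed simp
  then have "AE t in lebesgue. t \<notin> (\<Union>i\<in>{1..N}. frontier (I i))"
    by (intro AE_not_in) (simp add: negligible_iff_null_sets)
  then have "AE t in lebesgue. t \<in> {0<..<T} \<longrightarrow> (\<exists>i\<in>{1..N}. t \<in> I i)"
  proof eventually_elim
    case (elim t)
    show ?case
    proof
      assume "t \<in> {0<..<T}"
      then have "t \<in> (\<Union>i\<in>{1..N}. closure (I i))" unfolding cover by auto
      then obtain i where i: "i \<in> {1..N}" "t \<in> closure (I i)" by blast
      moreover have "t \<notin> frontier (I i)" using elim i by blast
      ultimately have "t \<in> I i"
        using cell[of i] by (auto simp: frontier_def interior_open)
      then show "\<exists>i\<in>{1..N}. t \<in> I i" using i by blast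
    qed
  qed
  then show ?thesis by (subst AE_restrict_space_iff) simp_all
qed

lemma integral_eq_sum_cells:
  fixes f :: "real \<Rightarrow> real"
  assumes "integrable M f"
  shows "(LINT t|M. f t) = (\<Sum>i\<in>{1..N}. (LINT t|M. indicator (I i) t * f t))"
proof -
  have "(LINT t|M. f t) = (LINT t|M. (\<Sum>i\<in>{1..N}. indicator (I i) t * f t))"
  proof (rule integral_cong_AE)
    show "AE t in M. f t = (\<Sum>i\<in>{1..N}. indicator (I i) t * f t)"
      using AE_in_cell
    proof eventually_elim
      case (elim t)
      then obtain i where "i \<in> {1..N}" "t \<in> I i" by blast
      then show ?case by (intro sum_indicator_cells[symmetric])
    qed
    show "f \<in> borel_measurable M" using assms by (rule borel_measurable_integrable)
    show "(\<lambda>t. \<Sum>i\<in>{1..N}. indicator (I i) t * f t) \<in> borel_measurable M"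
      using integrable_indicator_mult[OF _ assms] by (intro borel_measurable_sum borel_measurable_integrable)
  qed
  also have "\<dots> = (\<Sum>i\<in>{1..N}. (LINT t|M. indicator (I i) t * f t))"
    by (intro Bochner_Integration.integral_sum integrable_indicator_mult assms)
  finally show ?thesis .
qed

text \<open>
  The sign \<open>s\<close> of \<open>e\<close> is split into its cellwise average \<open>a\<close>, which is bounded by \<open>1\<close>, and the remainder
  \<open>g = s - a\<close>, which has mean zero on every cell.  The integral of \<open>e \<cdot> a\<close> is a combination of the cell
  integrals of \<open>e\<close> with coefficients in \<open>[-1,1]\<close>.
\<close>

lemma oscillating_multiplier:
  fixes e :: "real \<Rightarrow> real"
  assumes e: "integrable M e"
  obtains g :: "real \<Rightarrow> real" where "g \<in> borel_measurable M" "\<And>t. \<bar>g t\<bar> \<le> 2"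
    "\<And>i. i \<in> {1..N} \<Longrightarrow> (LINT t|M. indicator (I i) t * g t) = 0"
    "(LINT t|M. \<bar>e t\<bar>) \<le> (\<Sum>i\<in>{1..N}. \<bar>LINT t|M. indicator (I i) t * e t\<bar>) + (LINT t|M. e t * g t)"
proof
  define s where "s = (\<lambda>t. sgn (e t))"
  define c where "c i = (LINT t|M. indicator (I i) t * s t) / measure lebesgue (I i)" for i
  define a where "a = (\<lambda>t. \<Sum>i\<in>{1..N}. indicator (I i) t * c i)"
  define g where "g = (\<lambda>t. s t - a t)"
  have s_meas: "s \<in> borel_measurable M" using e unfolding s_def by measurable
  have s1: "\<bar>s t\<bar> \<le> 1" for t by (simp add: s_def sgn_if)
  have s_int: "integrable M s"
    using s1 s_meas by (intro integrable_const_bound[where B = 1]) auto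
  have ind: "(LINT t|M. indicator (I i) t) = measure lebesgue (I i)" if "i \<in> {1..N}" for i
    using measure_M_cell[OF that] cell[OF that] by (simp add: Int_absorb2)
  have ind_int: "integrable M (indicator (I i) :: real \<Rightarrow> real)" if "i \<in> {1..N}" for i
    using cell_in_M[OF that] by (simp add: less_top[symmetric])
  have c1: "\<bar>c i\<bar> \<le> 1" if i: "i \<in> {1..N}" for i
  proof -
    have "\<bar>LINT t|M. indicator (I i) t * s t\<bar> \<le> (LINT t|M. \<bar>indicator (I i) t * s t\<bar>)"
      by (rule integral_abs_bound)
    also have "\<dots> \<le> (LINT t|M. indicator (I i) t)"
      using s1 integrable_indicator_mult[OF i s_int] ind_int[OF i]
      by (intro integral_mono) (auto split: split_indicator)
    finally show ?thesis using cell_measure_pos[OF i] ind[OF i] by (simp add: c_def)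
  qed
  have a_meas: "a \<in> borel_measurable M"
    unfolding a_def using indicator_measurable by (intro borel_measurable_sum borel_measurable_times) auto
  have a_cell: "a t = c i" if "i \<in> {1..N}" "t \<in> I i" for i t
    unfolding a_def by (rule sum_indicator_cells[OF that(2,1)])
  have a1: "\<bar>a t\<bar> \<le> 1" for t
  proof (cases "\<exists>i\<in>{1..N}. t \<in> I i")
    case True
    then obtain i where "i \<in> {1..N}" "t \<in> I i" by blast
    then show ?thesis using c1[of i] a_cell[of i t] by simp
  next
    case False
    then have "a t = 0" unfolding a_def by (intro sum.neutral) auto
    then show ?thesis by simp
  qed
  have a_int: "integrable M a"
    using a1 a_meas by (intro integrable_const_bound[where B = 1]) auto
  show "g \<in> borel_measurable M" unfolding g_def using s_meas a_meas by measurable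
  show "\<bar>g t\<bar> \<le> 2" for t using s1[of t] a1[of t] by (auto simp: g_def)
  show "(LINT t|M. indicator (I i) t * g t) = 0" if i: "i \<in> {1..N}" for i
  proof -
    have "(LINT t|M. indicator (I i) t * a t) = (LINT t|M. indicator (I i) t * c i)"
      using i by (intro Bochner_Integration.integral_cong) (auto simp: a_cell split: split_indicator)
    also have "\<dots> = measure lebesgue (I i) * c i"
      using ind[OF i] ind_int[OF i] by simp
    also have "\<dots> = (LINT t|M. indicator (I i) t * s t)"
      using cell_measure_pos[OF i] by (simp add: c_def)
    finally show ?thesis
      using integrable_indicator_mult[OF i s_int] integrable_indicator_mult[OF i a_int]
      by (simp add: g_def right_diff_distrib)
  qed
  have mult_int: "integrable M (\<lambda>t. e t * u t)" if "u \<in> borel_measurable M" "\<And>t. \<bar>u t\<bar> \<le> 1" for u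
    by (rule integrable_mult_bounded[OF e that])
  have "(LINT t|M. \<bar>e t\<bar>) = (LINT t|M. e t * s t)"
    by (intro Bochner_Integration.integral_cong) (auto simp: s_def sgn_if)
  also have "\<dots> = (LINT t|M. e t * g t) + (LINT t|M. e t * a t)"
    unfolding g_def using mult_int[OF s_meas s1] mult_int[OF a_meas a1] by (simp add: right_diff_distrib)
  also have "(LINT t|M. e t * a t) = (LINT t|M. (\<Sum>i\<in>{1..N}. (indicator (I i) t * e t) * c i))"
    by (simp only: a_def sum_distrib_left mult_ac)
  also have "\<dots> = (\<Sum>i\<in>{1..N}. (LINT t|M. indicator (I i) t * e t) * c i)"
    using integrable_indicator_mult[OF _ e] by (subst Bochner_Integration.integral_sum) auto
  also have "\<dots> \<le> (\<Sum>i\<in>{1..N}. \<bar>LINT t|M. indicator (I i) t * e t\<bar>)"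
  proof (rule sum_mono)
    fix i assume i: "i \<in> {1..N}"
    have "(LINT t|M. indicator (I i) t * e t) * c i \<le> \<bar>(LINT t|M. indicator (I i) t * e t) * c i\<bar>" by simp
    also have "\<dots> \<le> \<bar>LINT t|M. indicator (I i) t * e t\<bar>"
      using c1[OF i] by (simp add: abs_mult mult_left_le)
    finally show "(LINT t|M. indicator (I i) t * e t) * c i \<le> \<bar>LINT t|M. indicator (I i) t * e t\<bar>" .
  qed
  finally show "(LINT t|M. \<bar>e t\<bar>) \<le> (\<Sum>i\<in>{1..N}. \<bar>LINT t|M. indicator (I i) t * e t\<bar>) + (LINT t|M. e t * g t)"
    by linarith
qed

text \<open>
  The cells to the left of \<open>t\<close> contribute nothing to the primitive, and at most one cell contains \<open>t\<close>.
\<close>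

lemma primitive_le_mesh:
  fixes g :: "real \<Rightarrow> real"
  assumes g: "g \<in> borel_measurable M" "\<And>t. \<bar>g t\<bar> \<le> B"
    and zero: "\<And>i. i \<in> {1..N} \<Longrightarrow> (LINT t|M. indicator (I i) t * g t) = 0"
    and t: "t \<in> {0<..<T}"
  shows "\<bar>LINT s|lebesgue_on {0<..<t}. g s\<bar> \<le> B * mesh"
proof -
  have B: "B \<ge> 0" using order_trans[OF abs_ge_zero g(2)] .
  have sub: "{0<..<t} \<subseteq> {0<..<T}" using t by auto
  define u where "u = (\<lambda>s. indicator {0<..<t} s * g s)"
  have u_le: "\<bar>u s\<bar> \<le> B" for s using g(2)[of s] B by (auto simp: u_def split: split_indicator)
  have u_int: "integrable M u"
    using u_le g(1) borel_measurable_indicator_lebesgue_on[of "{0<..<t}" "{0<..<T}"]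
    by (intro integrable_const_bound[where B = B]) (auto simp: u_def)
  define J where "J i = (LINT s|M. indicator (I i) s * u s)" for i
  have J_zero: "J i = 0" if i: "i \<in> {1..N}" "t \<notin> I i" for i
  proof (cases "\<exists>s\<in>I i. s < t")
    case True
    then obtain s where s: "s \<in> I i" "s < t" by blast
    have "r < t" if "r \<in> I i" for r
    proof (rule ccontr)
      assume "\<not> r < t"
      then have "t \<in> I i"
        using mem_is_interval_1_I[of "I i" s r t] cell[OF i(1)] s that by auto
      then show False using i(2) by simp
    qed
    moreover have "0 < r" if "r \<in> I i" for r using cell[OF i(1)] that by auto
    ultimately have "J i = (LINT s|M. indicator (I i) s * g s)"
      unfolding J_def u_def by (intro Bochner_Integration.integral_cong) (auto split: split_indicator)
    then show ?thesis using zero[OF i(1)] by simp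
  next
    case False
    then have "indicator (I i) s * u s = 0" for s by (auto simp: u_def split: split_indicator)
    then show ?thesis unfolding J_def by (simp only: integral_zero)
  qed
  have J_le: "\<bar>J i\<bar> \<le> B * mesh" if i: "i \<in> {1..N}" for i
  proof -
    have ind_int: "integrable M (indicator (I i) :: real \<Rightarrow> real)"
      using cell_in_M[OF i] by (simp add: less_top[symmetric])
    have "\<bar>J i\<bar> \<le> (LINT s|M. \<bar>indicator (I i) s * u s\<bar>)"
      unfolding J_def by (rule integral_abs_bound)
    also have "\<dots> \<le> (LINT s|M. indicator (I i) s * B)"
      using u_le integrable_indicator_mult[OF i u_int] ind_int
      by (intro integral_mono) (auto split: split_indicator)
    also have "\<dots> = measure lebesgue (I i) * B"
      using ind_int measure_M_cell[OF i] cell[OF i] by (simp add: Int_absorb2)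
    also have "\<dots> \<le> B * mesh"
      using cell_measure_le_mesh[OF i] B by (simp add: mult.commute mult_left_mono)
    finally show ?thesis .
  qed
  have "(LINT s|lebesgue_on {0<..<t}. g s) = (LINT s|M. u s)"
    unfolding u_def by (intro integral_lebesgue_on_subset sub) auto
  also have "\<dots> = (\<Sum>i\<in>{1..N}. J i)"
    unfolding J_def by (rule integral_eq_sum_cells[OF u_int])
  finally have eq: "(LINT s|lebesgue_on {0<..<t}. g s) = (\<Sum>i\<in>{1..N}. J i)" .
  show ?thesis
  proof (cases "\<exists>i\<in>{1..N}. t \<in> I i")
    case True
    then obtain i where i: "i \<in> {1..N}" "t \<in> I i" by blast
    have "J l = (if l = i then J i else 0)" if "l \<in> {1..N}" for l
      using disjoint_family_onD[OF disjoint that i(1)] i(2) J_zero[OF that] by auto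
    then have "(\<Sum>l\<in>{1..N}. J l) = (\<Sum>l\<in>{1..N}. if l = i then J i else 0)"
      by (intro sum.cong) auto
    then show ?thesis using eq i J_le[OF i(1)] by simp
  next
    case False
    then have "(\<Sum>i\<in>{1..N}. J i) = 0" using J_zero by (intro sum.neutral) auto
    then show ?thesis using eq B mesh_nonneg by simp
  qed
qed

lemma integral_zero_of_cells:
  fixes g :: "real \<Rightarrow> real"
  assumes "integrable M g" "\<And>i. i \<in> {1..N} \<Longrightarrow> (LINT t|M. indicator (I i) t * g t) = 0"
  shows "(LINT t|M. g t) = 0"
  unfolding integral_eq_sum_cells[OF assms(1)] using assms(2) by (intro sum.neutral) auto

end

section \<open>Convergence and compactness in the mean\<close>

text \<open>
  The proof of Riesz and Fischer: along a subsequence \<open>r\<close> with \<open>\<integral>\<bar>f (r (n + 1)) - f (r n)\<bar> < (1 / 2) ^ n\<close> the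
  telescoping series converges absolutely almost everywhere, and the sum of the absolute values is an
  integrable bound for its partial sums.
\<close>

lemma L1_complete:
  fixes f :: "nat \<Rightarrow> 'a \<Rightarrow> real"
  assumes f: "\<And>n. integrable M (f n)"
    and Cauchy: "\<And>\<epsilon>. \<epsilon> > 0 \<Longrightarrow> \<exists>K. \<forall>m\<ge>K. \<forall>n\<ge>K. (LINT x|M. \<bar>f m x - f n x\<bar>) < \<epsilon>"
  obtains g where "integrable M g" "(\<lambda>n. LINT x|M. \<bar>f n x - g x\<bar>) \<longlonglongrightarrow> 0"
proof -
  have "\<exists>K. \<forall>m\<ge>K. \<forall>n\<ge>K. (LINT x|M. \<bar>f m x - f n x\<bar>) < (1 / 2) ^ i" for i :: nat
    by (rule Cauchy) simp
  then obtain K where K: "\<And>i m n. m \<ge> K i \<Longrightarrow> n \<ge> K i \<Longrightarrow> (LINT x|M. \<bar>f m x - f n x\<bar>) < (1 / 2) ^ i"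
    by metis
  \<comment> \<open>An explicit choice of indices that is increasing and dominates \<open>K\<close>.\<close>
  define r where "r n = n + (\<Sum>i\<le>n. K i)" for n
  have r_ge: "r n \<ge> K n" "r n \<ge> n" "r (Suc n) \<ge> r n" for n
    using member_le_sum[of n "{..n}" K] by (simp_all add: r_def)
  define d where "d = (\<lambda>n x. f (r (Suc n)) x - f (r n) x)"
  have d_int: "integrable M (d n)" for n using f by (simp add: d_def)
  have d_small: "(LINT x|M. \<bar>d n x\<bar>) < (1 / 2) ^ n" for n
    unfolding d_def using r_ge[of n] by (intro K) auto
  have summable_int: "summable (\<lambda>n. LINT x|M. norm (d n x))"
    by (rule summable_comparison_test'[where g = "\<lambda>n. (1 / 2 :: real) ^ n"])
       (use d_small in \<open>auto intro: less_imp_le\<close>)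
  have AE_summable: "AE x in M. summable (\<lambda>n. norm (d n x))"
  proof -
    have "(\<integral>\<^sup>+x. (\<Sum>n. ennreal (norm (d n x))) \<partial>M) = (\<Sum>n. \<integral>\<^sup>+x. ennreal (norm (d n x)) \<partial>M)"
      using d_int by (intro nn_integral_suminf) auto
    also have "\<dots> = (\<Sum>n. ennreal (LINT x|M. norm (d n x)))"
      using d_int by (intro suminf_cong nn_integral_eq_integral) auto
    also have "\<dots> \<noteq> \<infinity>"
      using summable_int by (subst suminf_ennreal2) auto
    finally have "AE x in M. (\<Sum>n. ennreal (norm (d n x))) \<noteq> \<infinity>"
      using d_int by (intro nn_integral_noteq_infinite) auto
    then show ?thesis
      by eventually_elim (auto intro: summable_suminf_not_top)
  qed
  define S where "S = (\<lambda>x. \<Sum>n. d n x)"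
  have S_int: "integrable M S"
    unfolding S_def by (rule integrable_suminf[OF d_int AE_summable summable_int])
  have W_int: "integrable M (\<lambda>x. \<Sum>n. norm (d n x))"
    using d_int AE_summable summable_int by (intro integrable_suminf) auto
  define g where "g x = f (r 0) x + S x" for x
  have g_int: "integrable M g" unfolding g_def using f S_int by simp
  have partial: "f (r n) x - g x = (\<Sum>i<n. d i x) - S x" for n x
    unfolding d_def g_def using sum_lessThan_telescope[of "\<lambda>i. f (r i) x" n] by linarith
  have "(\<lambda>n. LINT x|M. \<bar>f (r n) x - g x\<bar>) \<longlonglongrightarrow> (LINT x|M. 0)"
  proof (rule integral_dominated_convergence[where w = "\<lambda>x. 2 * (\<Sum>n. norm (d n x))"])
    show "AE x in M. (\<lambda>n. \<bar>f (r n) x - g x\<bar>) \<longlonglongrightarrow> 0"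
      using AE_summable
    proof eventually_elim
      case (elim x)
      have "(\<lambda>n. \<Sum>i<n. d i x) \<longlonglongrightarrow> S x"
        unfolding S_def by (rule summable_LIMSEQ[OF summable_norm_cancel[OF elim]])
      then have "(\<lambda>n. (\<Sum>i<n. d i x) - S x) \<longlonglongrightarrow> 0"
        using LIM_zero by blast
      then show ?case unfolding partial by (rule tendsto_rabs_zero)
    qed
    show "AE x in M. norm \<bar>f (r n) x - g x\<bar> \<le> 2 * (\<Sum>n. norm (d n x))" for n
      using AE_summable
    proof eventually_elim
      case (elim x)
      have "\<bar>S x\<bar> \<le> (\<Sum>n. norm (d n x))"
        unfolding S_def using summable_norm[OF elim] by simp
      moreover have "\<bar>\<Sum>i<n. d i x\<bar> \<le> (\<Sum>i<n. norm (d i x))"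
        using norm_sum[of "\<lambda>i. d i x" "{..<n}"] by simp
      moreover have "\<dots> \<le> (\<Sum>n. norm (d n x))"
        by (intro sum_le_suminf elim) auto
      ultimately have "\<bar>(\<Sum>i<n. d i x) - S x\<bar> \<le> 2 * (\<Sum>n. norm (d n x))" by linarith
      then show ?case by (simp add: partial)
    qed
  qed (use f g_int W_int in auto)
  then have sub: "(\<lambda>n. LINT x|M. \<bar>f (r n) x - g x\<bar>) \<longlonglongrightarrow> 0" by simp
  have "(\<lambda>n. LINT x|M. \<bar>f n x - g x\<bar>) \<longlonglongrightarrow> 0"
  proof (rule LIMSEQ_I)
    fix \<epsilon> :: real assume "\<epsilon> > 0"
    then obtain K1 where K1: "\<And>m n. m \<ge> K1 \<Longrightarrow> n \<ge> K1 \<Longrightarrow> (LINT x|M. \<bar>f m x - f n x\<bar>) < \<epsilon> / 2"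
      using Cauchy[of "\<epsilon> / 2"] by auto
    obtain K2 where K2: "\<And>n. n \<ge> K2 \<Longrightarrow> (LINT x|M. \<bar>f (r n) x - g x\<bar>) < \<epsilon> / 2"
      using LIMSEQ_D[OF sub, of "\<epsilon> / 2"] \<open>\<epsilon> > 0\<close> by auto
    have "norm ((LINT x|M. \<bar>f n x - g x\<bar>) - 0) < \<epsilon>" if n: "n \<ge> max K1 K2" for n
    proof -
      have "(LINT x|M. \<bar>f n x - g x\<bar>) \<le> (LINT x|M. \<bar>f n x - f (r n) x\<bar> + \<bar>f (r n) x - g x\<bar>)"
        using f g_int by (intro integral_mono) auto
      also have "\<dots> = (LINT x|M. \<bar>f n x - f (r n) x\<bar>) + (LINT x|M. \<bar>f (r n) x - g x\<bar>)"
        using f g_int by (intro Bochner_Integration.integral_add) auto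
      also have "\<dots> < \<epsilon> / 2 + \<epsilon> / 2"
        using n r_ge(2)[of n] by (intro add_strict_mono K1 K2) auto
      finally show ?thesis by simp
    qed
    then show "\<exists>no. \<forall>n\<ge>no. norm ((LINT x|M. \<bar>f n x - g x\<bar>) - 0) < \<epsilon>" by blast
  qed
  with g_int show ?thesis by (rule that)
qed

text \<open>
  The bound on the total variation is stated for each test function rather than by
  \<open>BV_seminorm\<close>, which keeps the reasoning in the reals and makes convexity evident.
\<close>

definition unit_BV_ball :: "real \<Rightarrow> real \<Rightarrow> (real \<Rightarrow> real) set"
  where "unit_BV_ball T C = {f \<in> borel_measurable (lebesgue_on {0<..<T}).
    (AE t in lebesgue_on {0<..<T}. f t \<in> {0..1}) \<and>
    (\<forall>\<phi>\<in>test_functions T. (\<forall>t. \<bar>\<phi> t\<bar> \<le> 1) \<longrightarrow> distributional_deriv T f \<phi> \<le> C)}"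

lemma unit_BV_ballD:
  assumes "f \<in> unit_BV_ball T C"
  shows "f \<in> borel_measurable (lebesgue_on {0<..<T})"
    "AE t in lebesgue_on {0<..<T}. f t \<in> {0..1}"
    "\<And>\<phi>. \<phi> \<in> test_functions T \<Longrightarrow> (\<And>t. \<bar>\<phi> t\<bar> \<le> 1) \<Longrightarrow> distributional_deriv T f \<phi> \<le> C"
    "integrable (lebesgue_on {0<..<T}) f"
proof -
  interpret finite_measure "lebesgue_on {0<..<T}"
    by (rule finite_measure_lebesgue_on_interval)
  show 1: "f \<in> borel_measurable (lebesgue_on {0<..<T})"
    and 2: "AE t in lebesgue_on {0<..<T}. f t \<in> {0..1}"
    and "\<And>\<phi>. \<phi> \<in> test_functions T \<Longrightarrow> (\<And>t. \<bar>\<phi> t\<bar> \<le> 1) \<Longrightarrow> distributional_deriv T f \<phi> \<le> C"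
    using assms by (auto simp: unit_BV_ball_def)
  have "AE t in lebesgue_on {0<..<T}. norm (f t) \<le> 1"
    using 2 by eventually_elim auto
  then show "integrable (lebesgue_on {0<..<T}) f"
    using 1 by (rule integrable_const_bound)
qed

context interval_partition
begin

lemma unit_BV_ball_integral_le:
  assumes f: "f \<in> unit_BV_ball T C"
    and g: "g \<in> borel_measurable M" "\<And>t. \<bar>g t\<bar> \<le> 2"
      "\<And>i. i \<in> {1..N} \<Longrightarrow> (LINT t|M. indicator (I i) t * g t) = 0"
  shows "\<bar>LINT t|M. f t * g t\<bar> \<le> 2 * mesh * C"
proof (rule BV_duality_primitive[OF T])
  show "AE t in M. \<bar>f t\<bar> \<le> 1"
    using unit_BV_ballD(2)[OF f] by eventually_elim auto
  show g_int: "integrable M g"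
    using g by (intro integrable_const_bound[where B = 2]) auto
  show "(LINT t|M. g t) = 0" by (rule integral_zero_of_cells[OF g_int g(3)])
  show "\<bar>LINT s|lebesgue_on {0<..<t}. g s\<bar> \<le> 2 * mesh" if "t \<in> {0<..<T}" for t
    by (rule primitive_le_mesh[OF g that])
qed (use unit_BV_ballD[OF f] in auto)

text \<open>
  The quantitative form of the fact that a function of bounded variation is determined, up to an
  error of the order of the mesh, by its cell integrals.
\<close>

lemma L1_dist_le_cell_integrals:
  assumes f: "f \<in> unit_BV_ball T C" and h: "h \<in> unit_BV_ball T C"
  shows "(LINT t|M. \<bar>f t - h t\<bar>) \<le>
    (\<Sum>i\<in>{1..N}. \<bar>(LINT t|M. indicator (I i) t * f t) - (LINT t|M. indicator (I i) t * h t)\<bar>)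
      + 4 * mesh * C"
proof -
  have int: "integrable M f" "integrable M h" using unit_BV_ballD(4) f h by auto
  then have "integrable M (\<lambda>t. f t - h t)" by simp
  then obtain g where g: "g \<in> borel_measurable M" "\<And>t. \<bar>g t\<bar> \<le> 2"
    "\<And>i. i \<in> {1..N} \<Longrightarrow> (LINT t|M. indicator (I i) t * g t) = 0"
    "(LINT t|M. \<bar>f t - h t\<bar>) \<le> (\<Sum>i\<in>{1..N}. \<bar>LINT t|M. indicator (I i) t * (f t - h t)\<bar>)
      + (LINT t|M. (f t - h t) * g t)"
    by (rule oscillating_multiplier) blast
  have "(LINT t|M. (f t - h t) * g t) = (LINT t|M. f t * g t) - (LINT t|M. h t * g t)"
    using integrable_mult_bounded[OF _ g(1,2)] int by (simp add: left_diff_distrib)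
  also have "\<dots> \<le> 4 * mesh * C"
    using unit_BV_ball_integral_le[OF f g(1-3)] unit_BV_ball_integral_le[OF h g(1-3)] by simp
  finally have "(LINT t|M. (f t - h t) * g t) \<le> 4 * mesh * C" .
  moreover have "(LINT t|M. indicator (I i) t * (f t - h t))
      = (LINT t|M. indicator (I i) t * f t) - (LINT t|M. indicator (I i) t * h t)" if "i \<in> {1..N}" for i
    using integrable_indicator_mult[OF that int(1)] integrable_indicator_mult[OF that int(2)]
    by (simp add: right_diff_distrib)
  ultimately show ?thesis using g(4) by simp
qed

end

locale vanishing_mesh_partitions =
  fixes T :: real and N :: "nat \<Rightarrow> nat" and I :: "nat \<Rightarrow> nat \<Rightarrow> real set"
  assumes partition: "\<And>k. interval_partition T (N k) (I k)"
    and mesh: "(\<lambda>k. interval_partition.mesh (N k) (I k)) \<longlonglongrightarrow> 0"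
begin

abbreviation "M \<equiv> lebesgue_on {0<..<T}"

text \<open>
  With the multiplier \<open>g\<^sub>k\<close> of \<open>v - w\<^sub>k\<close>, whose cell integrals are zero,
  one has \<open>\<integral>\<bar>v - w\<^sub>k\<bar> \<le> \<integral>v g\<^sub>k - \<integral>w\<^sub>k g\<^sub>k\<close>: the first term tends to zero by weak convergence, the second
  by the uniform bound on the variation of \<open>w\<^sub>k\<close>.
\<close>

lemma L1_tendsto_of_equal_cell_integrals:
  assumes v: "integrable M v" and w: "\<And>k. w k \<in> unit_BV_ball T C"
    and eq: "\<And>k i. i \<in> {1..N k} \<Longrightarrow>
      (LINT t|M. indicator (I k i) t * v t) = (LINT t|M. indicator (I k i) t * w k t)"
  shows "(\<lambda>k. LINT t|M. \<bar>v t - w k t\<bar>) \<longlonglongrightarrow> 0"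
proof -
  note w_int = unit_BV_ballD(4)[OF w]
  let ?osc = "\<lambda>k g. g \<in> borel_measurable M \<and> (\<forall>t. \<bar>g t\<bar> \<le> 2) \<and>
      (\<forall>i\<in>{1..N k}. (LINT t|M. indicator (I k i) t * g t) = 0) \<and>
      (LINT t|M. \<bar>v t - w k t\<bar>) \<le> (LINT t|M. (v t - w k t) * g t)"
  have "\<exists>g. ?osc k g" for k
  proof -
    interpret P: interval_partition T "N k" "I k" by (rule partition)
    have "integrable M (\<lambda>t. v t - w k t)" using v w_int by simp
    then obtain g where g: "g \<in> borel_measurable M" "\<And>t. \<bar>g t\<bar> \<le> 2"
      "\<And>i. i \<in> {1..N k} \<Longrightarrow> (LINT t|M. indicator (I k i) t * g t) = 0"
      "(LINT t|M. \<bar>v t - w k t\<bar>) \<le> (\<Sum>i\<in>{1..N k}. \<bar>LINT t|M. indicator (I k i) t * (v t - w k t)\<bar>)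
        + (LINT t|M. (v t - w k t) * g t)"
      by (rule P.oscillating_multiplier) blast
    have "(LINT t|M. indicator (I k i) t * (v t - w k t)) = 0" if "i \<in> {1..N k}" for i
      using P.integrable_indicator_mult[OF that v] P.integrable_indicator_mult[OF that w_int[of k]] eq[OF that]
      by (simp add: right_diff_distrib)
    then have "(\<Sum>i\<in>{1..N k}. \<bar>LINT t|M. indicator (I k i) t * (v t - w k t)\<bar>) = 0"
      by (intro sum.neutral) auto
    then have "(LINT t|M. \<bar>v t - w k t\<bar>) \<le> (LINT t|M. (v t - w k t) * g t)"
      using g(4) by linarith
    with g(1-3) have "?osc k g" by blast
    then show ?thesis by (rule exI[of _ g])
  qed
  then have "\<exists>g. \<forall>k. ?osc k (g k)" by (intro choice allI)
  then obtain g where "\<forall>k. ?osc k (g k)" ..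
  then have g: "\<And>k. g k \<in> borel_measurable M" "\<And>k t. \<bar>g k t\<bar> \<le> 2"
    "\<And>k i. i \<in> {1..N k} \<Longrightarrow> (LINT t|M. indicator (I k i) t * g k t) = 0"
    "\<And>k. (LINT t|M. \<bar>v t - w k t\<bar>) \<le> (LINT t|M. (v t - w k t) * g k t)"
    by blast+
  let ?m = "\<lambda>k. interval_partition.mesh (N k) (I k)"
  have "(\<lambda>k. LINT t|M. v t * g k t) \<longlonglongrightarrow> 0"
  proof (rule weak_convergence_of_primitives[OF v g(1,2)])
    show "\<bar>LINT s|lebesgue_on {0<..<t}. g k s\<bar> \<le> 2 * ?m k" if "t \<in> {0<..<T}" for k t
      by (rule interval_partition.primitive_le_mesh[OF partition g(1-3) that])
    show "(\<lambda>k. 2 * ?m k) \<longlonglongrightarrow> 0" using tendsto_mult_right_zero[OF mesh] by simp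
  qed
  moreover have "(\<lambda>k. 2 * ?m k * C) \<longlonglongrightarrow> 0"
    using tendsto_mult_left_zero[OF tendsto_mult_right_zero[OF mesh, of 2], of C] by simp
  ultimately have lim: "(\<lambda>k. (LINT t|M. v t * g k t) + 2 * ?m k * C) \<longlonglongrightarrow> 0"
    using tendsto_add by fastforce
  have "(LINT t|M. \<bar>v t - w k t\<bar>) \<le> (LINT t|M. v t * g k t) + 2 * ?m k * C" for k
  proof -
    have "(LINT t|M. (v t - w k t) * g k t) = (LINT t|M. v t * g k t) - (LINT t|M. w k t * g k t)"
      using integrable_mult_bounded[OF v g(1,2)] integrable_mult_bounded[OF w_int g(1,2)]
      by (simp add: left_diff_distrib)
    moreover have "\<bar>LINT t|M. w k t * g k t\<bar> \<le> 2 * ?m k * C"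
      by (rule interval_partition.unit_BV_ball_integral_le[OF partition w g(1-3)])
    ultimately show ?thesis using g(4)[of k] by linarith
  qed
  then show ?thesis
    by (intro tendsto_sandwich[OF _ _ tendsto_const lim]) (auto intro!: always_eventually)
qed

text \<open>
  A diagonal subsequence makes the countably many cell integrals on all partitions converge at once.
  The finite index set of components is carried along so that one subsequence serves all of them.
\<close>

lemma unit_BV_ball_compact:
  fixes u :: "nat \<Rightarrow> 'j::finite \<Rightarrow> real \<Rightarrow> real"
  assumes u: "\<And>m j. u m j \<in> unit_BV_ball T C"
  obtains r g where "strict_mono (r :: nat \<Rightarrow> nat)" "\<And>j. integrable M (g j)"
    "\<And>j. (\<lambda>m. LINT t|M. \<bar>u (r m) j t - g j t\<bar>) \<longlonglongrightarrow> 0"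
proof -
  interpret finite_measure M by (rule finite_measure_lebesgue_on_interval)
  define a where "a m = (\<lambda>(j, k, i). LINT t|M. indicator (I k i) t * u m j t)" for m
  define S where "S = {(j :: 'j, k, i). i \<in> {1..N k}}"
  have a_bound: "norm (a m x) \<le> measure M (space M)" if "x \<in> S" for m x
  proof -
    obtain j k i where x: "x = (j, k, i)" "i \<in> {1..N k}" using \<open>x \<in> S\<close> unfolding S_def by auto
    interpret P: interval_partition T "N k" "I k" by (rule partition)
    have "norm (a m x) \<le> (LINT t|M. \<bar>indicator (I k i) t * u m j t\<bar>)"
      unfolding a_def x by (simp add: integral_abs_bound)
    also have "\<dots> \<le> (LINT t|M. 1)"
    proof (rule integral_mono_AE)
      show "AE t in M. \<bar>indicator (I k i) t * u m j t\<bar> \<le> 1"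
        using unit_BV_ballD(2)[OF u[of m j]] by eventually_elim (auto split: split_indicator)
    qed (use P.integrable_indicator_mult[OF x(2) unit_BV_ballD(4)[OF u]] in auto)
    finally show ?thesis by simp
  qed
  obtain r where r: "strict_mono r"
    and conv: "\<And>x. x \<in> S \<Longrightarrow> \<exists>l. (\<lambda>m. a (r m) x) \<longlonglongrightarrow> l"
  proof (rule function_convergent_subsequence[of S a, OF countableI_type a_bound])
    fix k :: "nat \<Rightarrow> nat"
    assume "strict_mono k" "\<And>x. x \<in> S \<Longrightarrow> \<exists>l. (\<lambda>m. a (k m) x) \<longlonglongrightarrow> l"
    then show thesis by (rule that)
  qed
  define l where "l j k i = lim (\<lambda>m. a (r m) (j, k, i))" for j k i
  have l: "(\<lambda>m. a (r m) (j, k, i)) \<longlonglongrightarrow> l j k i" if "i \<in> {1..N k}" for j k i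
    using conv[of "(j, k, i)"] that unfolding l_def S_def by (auto simp: convergent_LIMSEQ_iff[symmetric] convergent_def)
  have "\<exists>g. integrable M g \<and> (\<lambda>m. LINT t|M. \<bar>u (r m) j t - g t\<bar>) \<longlonglongrightarrow> 0" for j
  proof (rule L1_complete[of M "\<lambda>m. u (r m) j"])
    show "integrable M (u (r m) j)" for m by (rule unit_BV_ballD(4)[OF u])
    fix \<epsilon> :: real assume \<epsilon>: "\<epsilon> > 0"
    let ?m = "\<lambda>k. interval_partition.mesh (N k) (I k)"
    have "(\<lambda>k. 4 * ?m k * C) \<longlonglongrightarrow> 0"
      using tendsto_mult_left_zero[OF tendsto_mult_right_zero[OF mesh, of 4], of C] by simp
    then have "\<forall>\<^sub>F k in sequentially. 4 * ?m k * C < \<epsilon> / 3"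
      using \<epsilon> by (intro order_tendstoD) auto
    then obtain k where k: "4 * ?m k * C < \<epsilon> / 3"
      by (auto simp: eventually_sequentially)
    have "(\<lambda>m. \<Sum>i\<in>{1..N k}. \<bar>a (r m) (j, k, i) - l j k i\<bar>) \<longlonglongrightarrow> (\<Sum>i\<in>{1..N k}. \<bar>l j k i - l j k i\<bar>)"
      by (intro tendsto_intros l)
    then have "\<forall>\<^sub>F m in sequentially. (\<Sum>i\<in>{1..N k}. \<bar>a (r m) (j, k, i) - l j k i\<bar>) < \<epsilon> / 3"
      using \<epsilon> by (intro order_tendstoD) auto
    then obtain K where K: "\<And>m. m \<ge> K \<Longrightarrow> (\<Sum>i\<in>{1..N k}. \<bar>a (r m) (j, k, i) - l j k i\<bar>) < \<epsilon> / 3"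
      by (auto simp: eventually_sequentially)
    have "(LINT t|M. \<bar>u (r m) j t - u (r n) j t\<bar>) < \<epsilon>" if "m \<ge> K" "n \<ge> K" for m n
    proof -
      have "(LINT t|M. \<bar>u (r m) j t - u (r n) j t\<bar>)
          \<le> (\<Sum>i\<in>{1..N k}. \<bar>a (r m) (j, k, i) - a (r n) (j, k, i)\<bar>) + 4 * ?m k * C"
        using interval_partition.L1_dist_le_cell_integrals[OF partition u[of "r m" j] u[of "r n" j], of k]
        by (simp add: a_def)
      also have "(\<Sum>i\<in>{1..N k}. \<bar>a (r m) (j, k, i) - a (r n) (j, k, i)\<bar>)
          \<le> (\<Sum>i\<in>{1..N k}. \<bar>a (r m) (j, k, i) - l j k i\<bar> + \<bar>a (r n) (j, k, i) - l j k i\<bar>)"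
        by (intro sum_mono) auto
      also have "\<dots> = (\<Sum>i\<in>{1..N k}. \<bar>a (r m) (j, k, i) - l j k i\<bar>) + (\<Sum>i\<in>{1..N k}. \<bar>a (r n) (j, k, i) - l j k i\<bar>)"
        by (rule sum.distrib)
      finally show ?thesis using K[OF that(1)] K[OF that(2)] k by linarith
    qed
    then show "\<exists>K. \<forall>m\<ge>K. \<forall>n\<ge>K. (LINT t|M. \<bar>u (r m) j t - u (r n) j t\<bar>) < \<epsilon>" by blast
  qed (intro exI conjI)
  then have "\<exists>g. \<forall>j. integrable M (g j) \<and> (\<lambda>m. LINT t|M. \<bar>u (r m) j t - g j t\<bar>) \<longlonglongrightarrow> 0"
    by (intro choice allI)
  then obtain g where "\<forall>j. integrable M (g j) \<and> (\<lambda>m. LINT t|M. \<bar>u (r m) j t - g j t\<bar>) \<longlonglongrightarrow> 0" ..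
  with r show ?thesis by (intro that[of r g]) auto
qed

end

section \<open>Convex hulls of compact sets in finitely many coordinates\<close>

text \<open>
  Local averages on a partition live in a finite-dimensional subspace of a function space
  whose dimension depends on the partition, so Caratheodory's theorem is needed for subsets of the span
  of a finite set in an arbitrary real vector space.
\<close>

lemma affine_dependent_in_finite_span:
  fixes S :: "'a::real_vector set"
  assumes S: "finite S" "S \<subseteq> span B" and B: "finite B" and card: "card S > card B + 1"
  shows "affine_dependent S"
proof -
  obtain a where a: "a \<in> S" using card by fastforce
  let ?D = "(\<lambda>x. x - a) ` (S - {a})"
  have "card ?D = card (S - {a})" by (intro card_image) (auto simp: inj_on_def)
  then have "card ?D > card B" using a S(1) card by simp
  moreover have "?D \<subseteq> span B" using S(2) a by (auto intro: span_diff)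
  ultimately have "dependent ?D"
    using independent_span_bound[OF B, of ?D] by force
  moreover have "{x - a |x. x \<in> S - {a}} = ?D" by blast
  ultimately have "dependent {x - a |x. x \<in> S - {a}}" by simp
  then have "affine_dependent (insert a (S - {a}))"
    by (rule dependent_imp_affine_dependent) simp
  then show ?thesis using a by (simp add: insert_absorb)
qed

text \<open>
  In a convex combination with the least number of points these are affinely independent: otherwise
  moving the weights along an affine dependence until one of them vanishes saves a point.
\<close>

lemma caratheodory_finite_span:
  fixes K :: "'a::real_vector set"
  assumes K: "K \<subseteq> span B" and B: "finite B" and y: "y \<in> convex hull K"
  shows "\<exists>S u. finite S \<and> S \<subseteq> K \<and> card S \<le> card B + 1 \<and> (\<forall>x\<in>S. 0 \<le> u x) \<and> sum u S = 1 \<and>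
    (\<Sum>v\<in>S. u v *\<^sub>R v) = y"
proof -
  let ?P = "\<lambda>n. \<exists>S u. finite S \<and> card S = n \<and> S \<subseteq> K \<and> (\<forall>x\<in>S. 0 \<le> u x) \<and>
    sum u S = 1 \<and> (\<Sum>v\<in>S. u v *\<^sub>R v) = y"
  have "\<exists>n. ?P n" using y unfolding convex_hull_explicit by blast
  then have P: "?P (LEAST n. ?P n)" by (rule LeastI_ex)
  define n where "n = (LEAST n. ?P n)"
  obtain S u where S: "finite S" "card S = n" "S \<subseteq> K" and u: "\<forall>x\<in>S. 0 \<le> u x" "sum u S = 1"
    "(\<Sum>v\<in>S. u v *\<^sub>R v) = y"
    using P unfolding n_def[symmetric] by blast
  have "card S \<le> card B + 1"
  proof (rule ccontr)
    assume "\<not> card S \<le> card B + 1"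
    then have "affine_dependent S" using S K B by (intro affine_dependent_in_finite_span[of S B]) auto
    then obtain w v where w: "sum w S = 0" "v \<in> S" "w v \<noteq> 0" "(\<Sum>x\<in>S. w x *\<^sub>R x) = 0"
      using affine_dependent_explicit_finite[OF S(1)] by auto
    have "\<exists>x\<in>S. w x < 0"
    proof (rule ccontr)
      assume "\<not> (\<exists>x\<in>S. w x < 0)"
      then have "\<forall>x\<in>S. w x = 0" using w(1) S(1) by (subst (asm) sum_nonneg_eq_0_iff) (auto simp: not_less)
      then show False using w by blast
    qed
    \<comment> \<open>The least \<open>t\<close> at which a weight \<open>u x + t \<cdot> w x\<close> reaches zero is the minimum of \<open>i\<close>.\<close>
    define i where "i = (\<lambda>x. u x / (- w x)) ` {x \<in> S. w x < 0}"
    define t where "t = Min i"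
    have fin: "finite i" "i \<noteq> {}" using S(1) \<open>\<exists>x\<in>S. w x < 0\<close> by (auto simp: i_def)
    have "t \<ge> 0" unfolding t_def using fin u(1) by (subst Min_ge_iff) (auto simp: i_def divide_nonneg_neg)
    have nonneg: "u x + t * w x \<ge> 0" if x: "x \<in> S" for x
    proof (cases "w x < 0")
      case True
      then have "t \<le> u x / (- w x)" unfolding t_def using fin x by (intro Min_le) (auto simp: i_def)
      then show ?thesis using True by (simp add: field_simps)
    next
      case False
      then show ?thesis using u(1) x \<open>t \<ge> 0\<close> by simp
    qed
    have "t \<in> i" unfolding t_def using fin by (intro Min_in)
    then obtain a where a: "a \<in> S" "w a < 0" "t = u a / (- w a)" by (auto simp: i_def)
    then have a0: "u a + t * w a = 0" by (simp add: field_simps)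
    let ?u = "\<lambda>x. u x + t * w x"
    have "sum ?u S = 1" using u(2) w(1) by (simp add: sum.distrib sum_distrib_left[symmetric])
    then have "sum ?u (S - {a}) = 1" using a0 a(1) S(1) by (simp add: sum_diff1)
    moreover have "(\<Sum>x\<in>S. ?u x *\<^sub>R x) = y"
      using u(3) w(4) by (simp add: scaleR_add_left sum.distrib scaleR_scaleR[symmetric] scaleR_sum_right[symmetric] del: scaleR_scaleR)
    then have "(\<Sum>x\<in>S - {a}. ?u x *\<^sub>R x) = y" using a0 a(1) S(1) by (simp add: sum_diff1)
    moreover have "finite (S - {a})" "card (S - {a}) = n - 1" "S - {a} \<subseteq> K" "\<forall>x\<in>S - {a}. 0 \<le> ?u x"
      using S a(1) nonneg by auto
    ultimately have "?P (n - 1)" by (intro exI[of _ "S - {a}"] exI[of _ ?u] conjI)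
    moreover have "n - 1 < n" using a(1) S(1,2) card_gt_0_iff[of S] by auto
    ultimately show False using not_less_Least[of "n - 1" ?P] unfolding n_def by blast
  qed
  then show ?thesis using S u by (intro exI[of _ S] exI[of _ u] conjI)
qed

text \<open>
  The points obtained from \<open>K\<close> by joining \<open>n\<close> times a point of \<open>K\<close> to a point obtained before, that is, the
  convex combinations of at most \<open>n + 1\<close> points.  In this form compactness passes through the
  recursion.
\<close>

fun iterated_segments :: "nat \<Rightarrow> 'a::real_vector set \<Rightarrow> 'a set" where
  "iterated_segments 0 K = K"
| "iterated_segments (Suc n) K =
    (\<lambda>(t, x, y). (1 - t) *\<^sub>R x + t *\<^sub>R y) ` ({0..1} \<times> K \<times> iterated_segments n K)"

lemma iterated_segments_subset_hull: "iterated_segments n K \<subseteq> convex hull K"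
proof (induction n)
  case (Suc n)
  show ?case
  proof
    fix z assume "z \<in> iterated_segments (Suc n) K"
    then obtain t x y where "0 \<le> t" "t \<le> 1" "x \<in> K" "y \<in> iterated_segments n K"
      and z: "z = (1 - t) *\<^sub>R x + t *\<^sub>R y" by auto
    then show "z \<in> convex hull K"
      unfolding z using Suc.IH by (intro convexD_alt convex_convex_hull) (auto intro: hull_inc)
  qed
qed (simp add: hull_subset)

text \<open>
  One point \<open>a\<close> is split off and the other weights are divided by \<open>1 - u a\<close>.  If \<open>u a = 1\<close>, the
  combination is \<open>a\<close> itself.
\<close>

lemma convex_combination_in_iterated_segments:
  assumes "finite S" "S \<subseteq> K" "S \<noteq> {}" "card S \<le> Suc n" "\<forall>x\<in>S. 0 \<le> u x" "sum u S = 1"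
  shows "(\<Sum>v\<in>S. u v *\<^sub>R v) \<in> iterated_segments n K"
  using assms
proof (induction n arbitrary: S u)
  case 0
  then have "card S = 1" using card_gt_0_iff[of S] by linarith
  then obtain a where "S = {a}" using card_1_singletonE by blast
  then show ?case using 0 by simp
next
  case (Suc n)
  obtain a where a: "a \<in> S" using Suc.prems(3) by blast
  show ?case
  proof (cases "u a = 1")
    case True
    then have "sum u (S - {a}) = 0" using Suc.prems a by (simp add: sum_diff1)
    then have "\<forall>x\<in>S - {a}. u x = 0" using Suc.prems by (subst (asm) sum_nonneg_eq_0_iff) auto
    then have "(\<Sum>v\<in>S - {a}. u v *\<^sub>R v) = 0" by (intro sum.neutral) auto
    then have eq: "(\<Sum>v\<in>S. u v *\<^sub>R v) = a" using True Suc.prems(1) a by (simp add: sum.remove)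
    have K: "a \<in> K" using a Suc.prems(2) by blast
    have "a \<in> iterated_segments n K"
      using Suc.IH[of "{a}" "\<lambda>_. 1"] K by simp
    then have "(\<lambda>(t, x, y). (1 - t) *\<^sub>R x + t *\<^sub>R y) (0, a, a) \<in> iterated_segments (Suc n) K"
      unfolding iterated_segments.simps using K by (intro imageI) auto
    then show ?thesis using eq by simp
  next
    case False
    have sum': "sum u (S - {a}) = 1 - u a" using Suc.prems a by (simp add: sum_diff1)
    have "sum u (S - {a}) \<ge> 0" using Suc.prems by (intro sum_nonneg) auto
    then have ua: "u a < 1" "0 \<le> u a" using sum' False Suc.prems(5) a by auto
    define y where "y = (\<Sum>v\<in>S - {a}. (u v / (1 - u a)) *\<^sub>R v)"
    have "y \<in> iterated_segments n K"
      unfolding y_def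
    proof (rule Suc.IH)
      show "S - {a} \<noteq> {}" using sum' False by force
      show "card (S - {a}) \<le> Suc n" using Suc.prems a by simp
      show "(\<Sum>v\<in>S - {a}. u v / (1 - u a)) = 1"
        using sum' False by (simp add: sum_divide_distrib[symmetric])
    qed (use Suc.prems ua in auto)
    moreover have "(\<Sum>v\<in>S. u v *\<^sub>R v) = (1 - (1 - u a)) *\<^sub>R a + (1 - u a) *\<^sub>R y"
      using Suc.prems(1) a False by (simp add: y_def scaleR_sum_right sum.remove)
    ultimately have "\<exists>z\<in>{0..1} \<times> K \<times> iterated_segments n K.
        (\<Sum>v\<in>S. u v *\<^sub>R v) = (\<lambda>(t, x, y). (1 - t) *\<^sub>R x + t *\<^sub>R y) z"
      using ua a Suc.prems(2) by (intro bexI[of _ "(1 - u a, a, y)"]) auto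
    then show ?thesis unfolding iterated_segments.simps image_iff .
  qed
qed

lemma convex_hull_eq_iterated_segments:
  assumes "K \<subseteq> span B" "finite B"
  shows "convex hull K = iterated_segments (card B) K"
proof
  show "convex hull K \<subseteq> iterated_segments (card B) K"
  proof
    fix y assume "y \<in> convex hull K"
    then obtain S u where S: "finite S" "S \<subseteq> K" "card S \<le> card B + 1" "\<forall>x\<in>S. 0 \<le> u x" "sum u S = 1"
      "(\<Sum>v\<in>S. u v *\<^sub>R v) = y"
      using caratheodory_finite_span[OF assms] by blast
    moreover have "S \<noteq> {}" using S(5) by auto
    ultimately show "y \<in> iterated_segments (card B) K"
      using convex_combination_in_iterated_segments[of S K "card B" u] by simp
  qed
qed (rule iterated_segments_subset_hull)

lemma compact_iterated_segments:
  fixes K :: "('a::countable \<Rightarrow> real) set"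
  assumes "compact K"
  shows "compact (iterated_segments n K)"
proof (induction n)
  case (Suc n)
  have "continuous_on X (\<lambda>(t, x, y). (1 - t) *\<^sub>R x + t *\<^sub>R y)" for X :: "(real \<times> ('a \<Rightarrow> real) \<times> ('a \<Rightarrow> real)) set"
  proof (rule continuous_on_coordinatewise_then_product)
    fix i
    have "continuous_on X (\<lambda>z. (1 - fst z) * fst (snd z) i + fst z * snd (snd z) i)"
      by (intro continuous_intros continuous_on_product_then_coordinatewise)
    then show "continuous_on X (\<lambda>z. (case z of (t, x, y) \<Rightarrow> (1 - t) *\<^sub>R x + t *\<^sub>R y) i)"
      by (simp add: case_prod_unfold scaleR_fun_def)
  qed
  then show ?case
    using Suc assms unfolding iterated_segments.simps
    by (intro compact_continuous_image compact_Times) auto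
qed (simp add: assms)

text \<open>
  The topology is that of pointwise convergence.  The common finite support \<open>F\<close> makes the
  functions combinations of finitely many unit vectors and so bounds the number of points in
  Caratheodory's theorem.
\<close>

lemma compact_convex_hull_fun:
  fixes K :: "('a::countable \<Rightarrow> real) set"
  assumes "compact K" and F: "finite F" and supp: "\<And>x i. x \<in> K \<Longrightarrow> i \<notin> F \<Longrightarrow> x i = 0"
  shows "compact (convex hull K)"
proof -
  define e where "e i = (\<lambda>j. if j = i then 1 else 0 :: real)" for i :: 'a
  have "x \<in> span (e ` F)" if "x \<in> K" for x
  proof -
    have "x = (\<Sum>i\<in>F. x i *\<^sub>R e i)"
    proof
      fix j
      have "(\<Sum>i\<in>F. x i *\<^sub>R e i) j = (\<Sum>i\<in>F. x i * (if j = i then 1 else 0))"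
        using F by (induction F rule: finite_induct) (auto simp: e_def scaleR_fun_def)
      also have "\<dots> = (\<Sum>i\<in>F. if i = j then x i else 0)" by (intro sum.cong) auto
      also have "\<dots> = x j" using F supp[OF that, of j] by simp
      finally show "x j = (\<Sum>i\<in>F. x i *\<^sub>R e i) j" by simp
    qed
    also have "\<dots> \<in> span (e ` F)" by (intro span_sum span_scale span_base imageI)
    finally show ?thesis .
  qed
  then have "convex hull K = iterated_segments (card (e ` F)) K"
    using F by (intro convex_hull_eq_iterated_segments) auto
  then show ?thesis using compact_iterated_segments[OF assms(1)] by simp
qed

section \<open>Vector-valued functions in the spaces of order p\<close>

lemma borel_measurable_vec_component:
  assumes "u \<in> borel_measurable N"
  shows "(\<lambda>t. (u t :: real ^ 'n) $ j) \<in> borel_measurable N"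
  using assms by (rule measurable_compose) (intro borel_measurable_continuous_onI continuous_intros)

lemma borel_measurable_vecI:
  fixes u :: "'a \<Rightarrow> real ^ 'n"
  assumes "\<And>j. (\<lambda>t. u t $ j) \<in> borel_measurable N"
  shows "u \<in> borel_measurable N"
  by (subst borel_measurable_euclidean_space) (use assms in \<open>auto simp: Basis_vec_def inner_axis\<close>)

text \<open>
  An elementary substitute for Hoelder's inequality on a bounded interval; letting \<open>\<delta>\<close> tend to zero after
  the \<open>p\<close>-th moment shows that convergence in \<open>L\<^sup>p\<close> implies convergence in \<open>L\<^sup>1\<close>.
\<close>

lemma Lp_powr_bound:
  fixes n p \<delta> :: real
  assumes "n \<ge> 0" "p \<ge> 1" "\<delta> > 0"
  shows "n \<le> \<delta> + \<delta> powr (1 - p) * n powr p"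
proof (cases "n \<le> \<delta>")
  case True
  then show ?thesis using assms by (simp add: add_increasing2)
next
  case False
  then have n: "n > \<delta>" "n > 0" using assms by auto
  have "1 \<le> (n / \<delta>) powr (p - 1)" using n assms by (intro ge_one_powr_ge_zero) auto
  also have "\<dots> = \<delta> powr (1 - p) * n powr (p - 1)"
    using n assms by (simp add: powr_divide powr_minus_divide[of \<delta> "p - 1", simplified])
  finally have "n * 1 \<le> n * (\<delta> powr (1 - p) * n powr (p - 1))" using n by (intro mult_left_mono) auto
  also have "\<dots> = \<delta> powr (1 - p) * n powr p"
    using powr_mult_base[of n "p - 1"] n by (simp add: mult.left_commute)
  finally show ?thesis using assms by simp
qed

lemma Lp_diff:
  assumes "v \<in> Lp T p" "w \<in> Lp T p" "p \<ge> 1"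
  shows "(\<lambda>t. v t - w t) \<in> Lp T p"
proof -
  let ?M = "lebesgue_on {0<..<T}"
  have meas: "v \<in> borel_measurable ?M" "w \<in> borel_measurable ?M"
    and int: "integrable ?M (\<lambda>t. norm (v t) powr p)" "integrable ?M (\<lambda>t. norm (w t) powr p)"
    using assms by (auto simp: Lp_def)
  have "integrable ?M (\<lambda>t. norm (v t - w t) powr p)"
  proof (rule Bochner_Integration.integrable_bound)
    show "integrable ?M (\<lambda>t. 2 powr p * (norm (v t) powr p + norm (w t) powr p))"
      using int by auto
    show "(\<lambda>t. norm (v t - w t) powr p) \<in> borel_measurable ?M" using meas by measurable
    show "AE t in ?M. norm (norm (v t - w t) powr p) \<le> norm (2 powr p * (norm (v t) powr p + norm (w t) powr p))"
    proof (rule AE_I2)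
      fix t
      have "norm (v t - w t) \<le> 2 * max (norm (v t)) (norm (w t))"
        using norm_triangle_ineq4[of "v t" "w t"] by simp
      then have "norm (v t - w t) powr p \<le> (2 * max (norm (v t)) (norm (w t))) powr p"
        using assms(3) by (intro powr_mono2) auto
      also have "\<dots> = 2 powr p * (max (norm (v t)) (norm (w t)) powr p)"
        by (subst powr_mult) (auto simp: max_def)
      also have "\<dots> \<le> 2 powr p * (norm (v t) powr p + norm (w t) powr p)"
        by (intro mult_left_mono) (auto simp: max_def)
      finally show "norm (norm (v t - w t) powr p) \<le> norm (2 powr p * (norm (v t) powr p + norm (w t) powr p))"
        by simp
    qed
  qed
  then show ?thesis using meas by (simp add: Lp_def)
qed

lemma Lp_component_L1:
  assumes u: "u \<in> Lp T p" and p: "p \<ge> 1"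
  shows "integrable (lebesgue_on {0<..<T}) (\<lambda>t. u t $ j)"
    and "\<delta> > 0 \<Longrightarrow> T > 0 \<Longrightarrow> (LINT t|lebesgue_on {0<..<T}. \<bar>u t $ j\<bar>) \<le>
      \<delta> * T + \<delta> powr (1 - p) * (LINT t|lebesgue_on {0<..<T}. norm (u t) powr p)"
proof -
  let ?M = "lebesgue_on {0<..<T}"
  interpret finite_measure ?M by (rule finite_measure_lebesgue_on_interval)
  have meas: "(\<lambda>t. u t $ j) \<in> borel_measurable ?M"
    and int: "integrable ?M (\<lambda>t. norm (u t) powr p)"
    using u borel_measurable_vec_component by (auto simp: Lp_def)
  have le: "\<bar>u t $ j\<bar> \<le> \<delta> + \<delta> powr (1 - p) * norm (u t) powr p" if "\<delta> > 0" for t \<delta>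
    using component_le_norm_cart[of "u t" j] Lp_powr_bound[OF norm_ge_zero p that, of "u t"] by linarith
  have bound_int: "integrable ?M (\<lambda>t. \<delta> + \<delta> powr (1 - p) * norm (u t) powr p)" for \<delta>
    using int by simp
  show comp: "integrable ?M (\<lambda>t. u t $ j)"
    by (rule Bochner_Integration.integrable_bound[OF bound_int[of 1] meas])
       (use le[of 1] in \<open>auto intro!: AE_I2 order_trans[OF _ abs_ge_self]\<close>)
  assume "\<delta> > 0" "T > 0"
  have "(LINT t|?M. \<bar>u t $ j\<bar>) \<le> (LINT t|?M. \<delta> + \<delta> powr (1 - p) * norm (u t) powr p)"
    using comp bound_int le[OF \<open>\<delta> > 0\<close>] by (intro integral_mono) auto
  also have "\<dots> = (LINT t|?M. \<delta>) + \<delta> powr (1 - p) * (LINT t|?M. norm (u t) powr p)"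
    using int by (subst Bochner_Integration.integral_add) auto
  also have "(LINT t|?M. \<delta>) = \<delta> * T"
    using \<open>T > 0\<close> by (simp add: measure_restrict_space)
  finally show "(LINT t|?M. \<bar>u t $ j\<bar>) \<le> \<delta> * T + \<delta> powr (1 - p) * (LINT t|?M. norm (u t) powr p)" .
qed

lemma L1_tendsto_of_Lp_tendsto:
  fixes v :: "real \<Rightarrow> real ^ 'n"
  assumes T: "T > 0" and p: "p \<ge> 1" and v: "v \<in> Lp T p" and w: "\<And>m::nat. w m \<in> Lp T p"
    and lim: "(\<lambda>m. Lp_norm T p (\<lambda>t. v t - w m t)) \<longlonglongrightarrow> 0"
  shows "(\<lambda>m. LINT t|lebesgue_on {0<..<T}. \<bar>v t $ j - w m t $ j\<bar>) \<longlonglongrightarrow> 0"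
proof -
  let ?M = "lebesgue_on {0<..<T}"
  define J where "J m = (LINT t|?M. norm (v t - w m t) powr p)" for m
  have "J m = Lp_norm T p (\<lambda>t. v t - w m t) powr p" for m
  proof -
    have "J m \<ge> 0" by (simp add: J_def)
    then show ?thesis using p unfolding Lp_norm_def J_def[symmetric] by (simp add: powr_powr)
  qed
  moreover have "(\<lambda>m. Lp_norm T p (\<lambda>t. v t - w m t) powr p) \<longlonglongrightarrow> 0 powr p"
    using p by (intro tendsto_powr2[OF lim tendsto_const]) (auto simp: Lp_norm_def)
  ultimately have J: "J \<longlonglongrightarrow> 0" by (simp add: J_def[abs_def])
  show ?thesis
  proof (rule LIMSEQ_I)
    fix r :: real assume r: "r > 0"
    \<comment> \<open>Then \<open>\<delta> \<cdot> T\<close> uses up half of the tolerance \<open>r\<close>.\<close>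
    define \<delta> where "\<delta> = r / (2 * T)"
    have \<delta>: "\<delta> > 0" using r T by (simp add: \<delta>_def)
    have "(\<lambda>m. \<delta> * T + \<delta> powr (1 - p) * J m) \<longlonglongrightarrow> \<delta> * T + \<delta> powr (1 - p) * 0"
      by (intro tendsto_intros J)
    moreover have "\<delta> * T + \<delta> powr (1 - p) * 0 < r" using r T by (simp add: \<delta>_def)
    ultimately have "\<forall>\<^sub>F m in sequentially. \<delta> * T + \<delta> powr (1 - p) * J m < r"
      by (rule order_tendstoD)
    then obtain K where K: "\<And>m. m \<ge> K \<Longrightarrow> \<delta> * T + \<delta> powr (1 - p) * J m < r"
      by (auto simp: eventually_sequentially)
    have "norm ((LINT t|?M. \<bar>v t $ j - w m t $ j\<bar>) - 0) < r" if "m \<ge> K" for m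
      using Lp_component_L1(2)[OF Lp_diff[OF v w p] p \<delta> T, of m j] K[OF that]
      by (simp add: J_def)
    then show "\<exists>no. \<forall>m\<ge>no. norm ((LINT t|?M. \<bar>v t $ j - w m t $ j\<bar>) - 0) < r" by blast
  qed
qed

lemma AE_norm_le_of_unit_cube:
  fixes u :: "real \<Rightarrow> real ^ 'n"
  assumes "\<And>j. AE t in N. u t $ j \<in> {0..1}"
  shows "AE t in N. norm (u t) \<le> real CARD('n)"
proof -
  have "AE t in N. \<forall>j\<in>UNIV. u t $ j \<in> {0..1}"
    using assms by (intro AE_finite_allI) auto
  then show ?thesis
  proof eventually_elim
    case (elim t)
    have "norm (u t) \<le> (\<Sum>j\<in>UNIV. \<bar>u t $ j\<bar>)" by (rule norm_le_l1_cart)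
    also have "\<dots> \<le> (\<Sum>j\<in>(UNIV :: 'n set). 1)" using elim by (intro sum_mono) auto
    finally show ?case by simp
  qed
qed

lemma unit_cube_valued_in_Lp:
  fixes u :: "real \<Rightarrow> real ^ 'n"
  assumes meas: "u \<in> borel_measurable (lebesgue_on {0<..<T})"
    and unit: "\<And>j. AE t in lebesgue_on {0<..<T}. u t $ j \<in> {0..1}" and p: "p \<ge> 1"
  shows "u \<in> Lp T p"
proof -
  interpret finite_measure "lebesgue_on {0<..<T}" by (rule finite_measure_lebesgue_on_interval)
  have "AE t in lebesgue_on {0<..<T}. norm (norm (u t) powr p) \<le> real CARD('n) powr p"
    using AE_norm_le_of_unit_cube[OF unit] by eventually_elim (use p in \<open>auto intro: powr_mono2\<close>)
  then show ?thesis
    unfolding Lp_def using meas by (auto intro!: integrable_const_bound)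
qed

text \<open>
  For functions with values in the unit cube the \<open>p\<close>-th power of the distance is at most a constant
  times the distance.
\<close>

lemma Lp_tendsto_of_L1_tendsto:
  fixes v :: "real \<Rightarrow> real ^ 'n"
  assumes p: "p \<ge> 1"
    and v: "v \<in> borel_measurable (lebesgue_on {0<..<T})" "\<And>j. AE t in lebesgue_on {0<..<T}. v t $ j \<in> {0..1}"
    and w: "\<And>m::nat. w m \<in> borel_measurable (lebesgue_on {0<..<T})"
      "\<And>m j. AE t in lebesgue_on {0<..<T}. w m t $ j \<in> {0..1}"
    and lim: "\<And>j. (\<lambda>m. LINT t|lebesgue_on {0<..<T}. \<bar>v t $ j - w m t $ j\<bar>) \<longlonglongrightarrow> 0"
  shows "(\<lambda>m. Lp_norm T p (\<lambda>t. v t - w m t)) \<longlonglongrightarrow> 0"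
proof -
  let ?M = "lebesgue_on {0<..<T}"
  interpret finite_measure ?M by (rule finite_measure_lebesgue_on_interval)
  define B where "B = (2 * real CARD('n)) powr (p - 1)"
  have Lp: "v \<in> Lp T p" "w m \<in> Lp T p" for m
    using v w p by (auto intro: unit_cube_valued_in_Lp)
  have diff: "(\<lambda>t. v t - w m t) \<in> Lp T p" for m by (rule Lp_diff[OF Lp p])
  have comp_int: "integrable ?M (\<lambda>t. v t $ j - w m t $ j)" for j m
    using Lp_component_L1(1)[OF diff p] by simp
  define J where "J m = (LINT t|?M. norm (v t - w m t) powr p)" for m
  have le: "J m \<le> B * (\<Sum>j\<in>UNIV. LINT t|?M. \<bar>v t $ j - w m t $ j\<bar>)" for m
  proof -
    have "J m \<le> (LINT t|?M. B * (\<Sum>j\<in>UNIV. \<bar>v t $ j - w m t $ j\<bar>))"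
      unfolding J_def
    proof (rule integral_mono_AE)
      show "integrable ?M (\<lambda>t. norm (v t - w m t) powr p)" using diff[of m] by (simp add: Lp_def)
      show "integrable ?M (\<lambda>t. B * (\<Sum>j\<in>UNIV. \<bar>v t $ j - w m t $ j\<bar>))"
        using comp_int by auto
      show "AE t in ?M. norm (v t - w m t) powr p \<le> B * (\<Sum>j\<in>UNIV. \<bar>v t $ j - w m t $ j\<bar>)"
        using AE_norm_le_of_unit_cube[OF v(2)] AE_norm_le_of_unit_cube[OF w(2)[of m]]
      proof eventually_elim
        case (elim t)
        let ?n = "norm (v t - w m t)"
        have "?n \<le> 2 * real CARD('n)" using elim norm_triangle_ineq4[of "v t" "w m t"] by linarith
        then have "?n powr (p - 1) \<le> B" unfolding B_def using p by (intro powr_mono2) auto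
        then have "?n powr (p - 1) * ?n \<le> B * (\<Sum>j\<in>UNIV. \<bar>(v t - w m t) $ j\<bar>)"
          by (intro mult_mono norm_le_l1_cart) (auto simp: B_def)
        then show ?case using powr_mult_base[of ?n "p - 1"] by (simp add: mult.commute)
      qed
    qed
    also have "\<dots> = B * (\<Sum>j\<in>UNIV. LINT t|?M. \<bar>v t $ j - w m t $ j\<bar>)"
      using comp_int by (simp add: Bochner_Integration.integral_sum)
    finally show ?thesis .
  qed
  have "(\<lambda>m. B * (\<Sum>j\<in>UNIV. LINT t|?M. \<bar>v t $ j - w m t $ j\<bar>)) \<longlonglongrightarrow> B * (\<Sum>j\<in>(UNIV :: 'n set). 0)"
    by (intro tendsto_mult tendsto_const tendsto_sum lim)
  then have J: "J \<longlonglongrightarrow> 0"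
    using le by (intro tendsto_sandwich[OF _ _ tendsto_const, of _ J _ "\<lambda>m. B * (\<Sum>j\<in>UNIV. LINT t|?M. \<bar>v t $ j - w m t $ j\<bar>)"])
                (auto intro!: always_eventually simp: J_def)
  have "(\<lambda>m. J m powr (1 / p)) \<longlonglongrightarrow> 0 powr (1 / p)"
    using p by (intro tendsto_powr2[OF J tendsto_const]) (auto simp: J_def)
  then show ?thesis by (simp add: Lp_norm_def J_def)
qed

text \<open>
  The distance of \<open>g\<close> to \<open>[0,1]\<close> is at most \<open>\<bar>g - f\<^sub>m\<bar>\<close>, so its integral vanishes.
\<close>

lemma AE_unit_of_L1_limit:
  assumes g: "integrable M g" and f: "\<And>m::nat. integrable M (f m)" "\<And>m. AE t in M. f m t \<in> {0..1::real}"
    and lim: "(\<lambda>m. LINT t|M. \<bar>g t - f m t\<bar>) \<longlonglongrightarrow> 0"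
  shows "AE t in M. g t \<in> {0..1}"
proof -
  define h where "h = (\<lambda>t. \<bar>g t - max 0 (min 1 (g t))\<bar>)"
  have le: "AE t in M. h t \<le> \<bar>g t - f m t\<bar>" for m
    using f(2)[of m] by eventually_elim (auto simp: h_def)
  have h_int: "integrable M h"
    by (rule Bochner_Integration.integrable_bound[where f = "\<lambda>t. g t - f 0 t"])
       (use g f(1) le[of 0] in \<open>auto simp: h_def\<close>)
  have "(LINT t|M. h t) \<le> (LINT t|M. \<bar>g t - f m t\<bar>)" for m
    using h_int g f(1) le by (intro integral_mono_AE) auto
  then have "(LINT t|M. h t) \<le> 0"
    by (intro LIMSEQ_le_const[OF lim]) auto
  moreover have nonneg: "AE t in M. 0 \<le> h t" by (simp add: h_def)
  ultimately have "(LINT t|M. h t) = 0" using integral_nonneg_AE[OF nonneg] by linarith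
  then have "AE t in M. h t = 0"
    using integral_nonneg_eq_0_iff_AE[OF h_int nonneg] by blast
  then show ?thesis by eventually_elim (auto simp: h_def max_def min_def split: if_splits)
qed

section \<open>Local averages of the convex hull\<close>

lemma BV_seminorm_nonneg: "BV_seminorm T f \<ge> 0"
proof -
  have "ereal (distributional_deriv T f (\<lambda>t. 0)) \<le> BV_seminorm T f"
    unfolding BV_seminorm_def by (intro SUP_upper) (auto simp: zero_in_test_functions)
  then show ?thesis by (simp add: distributional_deriv_zero zero_ereal_def)
qed

text \<open>
  The seminorms of the components are summands of the \<open>BV\<close> norm, and the remaining summands are
  nonnegative.
\<close>

lemma component_in_unit_BV_ball:
  fixes u :: "real \<Rightarrow> real ^ 'n"
  assumes u: "u \<in> BV T" "AE t in lebesgue_on {0<..<T}. \<forall>j. u t $ j \<in> {0, 1}"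
    and C: "BV_norm T u \<le> ereal C"
  shows "(\<lambda>t. u t $ j) \<in> unit_BV_ball T C"
proof -
  have "u \<in> borel_measurable (lebesgue_on {0<..<T})" using u(1) by (auto simp: BV_def Lp_def)
  then have "(\<lambda>t. u t $ j) \<in> borel_measurable (lebesgue_on {0<..<T})" by (rule borel_measurable_vec_component)
  moreover have "AE t in lebesgue_on {0<..<T}. u t $ j \<in> {0..1}"
    using u(2)
  proof eventually_elim
    case (elim t)
    then have "u t $ j \<in> {0, 1}" by blast
    then show ?case by auto
  qed
  moreover have "distributional_deriv T (\<lambda>t. u t $ j) \<phi> \<le> C"
    if "\<phi> \<in> test_functions T" "\<forall>t. \<bar>\<phi> t\<bar> \<le> 1" for \<phi>
  proof -
    have "ereal (distributional_deriv T (\<lambda>t. u t $ j) \<phi>) \<le> BV_seminorm T (\<lambda>t. u t $ j)"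
      unfolding BV_seminorm_def using that by (intro SUP_upper) auto
    also have "\<dots> \<le> (\<Sum>j\<in>UNIV. BV_seminorm T (\<lambda>t. u t $ j))"
      using sum_mono2[of UNIV "{j}" "\<lambda>j. BV_seminorm T (\<lambda>t. u t $ j)"] by (simp add: BV_seminorm_nonneg)
    also have "\<dots> \<le> BV_norm T u"
      unfolding BV_norm_def by (intro ereal_le_add_self2) (auto simp: Lp_norm_def)
    also have "\<dots> \<le> ereal C" by (rule C)
    finally show ?thesis by simp
  qed
  ultimately show ?thesis by (simp add: unit_BV_ball_def)
qed

lemma convex_unit_BV_ball: "convex {w. \<forall>j. (\<lambda>t. (w t :: real ^ 'n) $ j) \<in> unit_BV_ball T C}"
proof (rule convexI, clarify)
  fix v w :: "real \<Rightarrow> real ^ 'n" and a b :: real and j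
  assume vw: "\<forall>j. (\<lambda>t. v t $ j) \<in> unit_BV_ball T C" "\<forall>j. (\<lambda>t. w t $ j) \<in> unit_BV_ball T C"
    and ab: "0 \<le> a" "0 \<le> b" "a + b = 1"
  let ?M = "lebesgue_on {0<..<T}"
  note v = unit_BV_ballD[OF vw(1)[rule_format, of j]] and w = unit_BV_ballD[OF vw(2)[rule_format, of j]]
  have eq: "(\<lambda>t. (a *\<^sub>R v + b *\<^sub>R w) t $ j) = (\<lambda>t. a * v t $ j + b * w t $ j)"
    by (simp add: scaleR_fun_def fun_eq_iff)
  have "AE t in ?M. a * v t $ j + b * w t $ j \<in> {0..1}"
    using v(2) w(2)
  proof eventually_elim
    case (elim t)
    then show ?case
      using ab convexD[OF convex_closed_interval[of 0 "1::real"], of "v t $ j" "w t $ j" a b] by simp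
  qed
  moreover have "distributional_deriv T (\<lambda>t. a * v t $ j + b * w t $ j) \<phi> \<le> C"
    if \<phi>: "\<phi> \<in> test_functions T" "\<forall>t. \<bar>\<phi> t\<bar> \<le> 1" for \<phi>
  proof -
    have "smooth \<phi>" using \<phi>(1) by (simp add: test_functions_altdef)
    then have d: "integrable ?M (deriv \<phi>)"
      by (intro integrable_continuous_on_interval smooth_continuous_on smooth_deriv)
    have int: "integrable ?M (\<lambda>t. f t * deriv \<phi> t)"
      if f: "f \<in> borel_measurable ?M" "AE t in ?M. f t \<in> {0..1}" for f
    proof (rule Bochner_Integration.integrable_bound[OF d])
      show "AE t in ?M. norm (f t * deriv \<phi> t) \<le> norm (deriv \<phi> t)"
        using f(2) by eventually_elim (auto simp: abs_mult mult_left_le_one_le)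
    qed (use d f(1) in auto)
    have "distributional_deriv T (\<lambda>t. a * v t $ j + b * w t $ j) \<phi>
      = a * distributional_deriv T (\<lambda>t. v t $ j) \<phi> + b * distributional_deriv T (\<lambda>t. w t $ j) \<phi>"
      using int[OF v(1,2)] int[OF w(1,2)]
      by (simp add: distributional_deriv_def distrib_right mult.assoc)
    also have "\<dots> \<le> a * C + b * C"
      using \<phi> ab by (intro add_mono mult_left_mono v(3) w(3)) auto
    also have "\<dots> = C" using ab by (simp add: distrib_right[symmetric])
    finally show ?thesis .
  qed
  ultimately show "(\<lambda>t. (a *\<^sub>R v + b *\<^sub>R w) t $ j) \<in> unit_BV_ball T C"
    unfolding eq unit_BV_ball_def using v(1) w(1) by auto
qed

context interval_partition
begin

lemma local_averages_eq:
  "local_averages N I u = (\<lambda>(j, i). if i \<in> {1..N} then (LINT t|M. indicator (I i) t * u t $ j) / measure lebesgue (I i) else 0)"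
  by (auto simp: local_averages_def fun_eq_iff cell_integral)

text \<open>
  Integrability is needed here, because the integral of a function that is not integrable is zero.
\<close>

lemma local_averages_linear:
  assumes "\<And>j. integrable M (\<lambda>t. v t $ j)" "\<And>j. integrable M (\<lambda>t. w t $ j)"
  shows "local_averages N I (a *\<^sub>R v + b *\<^sub>R w) = a *\<^sub>R local_averages N I v + b *\<^sub>R local_averages N I w"
proof (rule ext, clarify)
  fix j i
  show "local_averages N I (a *\<^sub>R v + b *\<^sub>R w) (j, i) = (a *\<^sub>R local_averages N I v + b *\<^sub>R local_averages N I w) (j, i)"
  proof (cases "i \<in> {1..N}")
    case True
    have "(LINT t|M. indicator (I i) t * (a *\<^sub>R v + b *\<^sub>R w) t $ j)
        = (LINT t|M. a * (indicator (I i) t * v t $ j) + b * (indicator (I i) t * w t $ j))"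
      by (simp add: scaleR_fun_def algebra_simps)
    also have "\<dots> = a * (LINT t|M. indicator (I i) t * v t $ j) + b * (LINT t|M. indicator (I i) t * w t $ j)"
      using integrable_indicator_mult[OF True assms(1)] integrable_indicator_mult[OF True assms(2)]
      by (subst Bochner_Integration.integral_add) auto
    finally show ?thesis using True by (simp add: local_averages_eq scaleR_fun_def add_divide_distrib)
  qed (auto simp: local_averages_eq scaleR_fun_def)
qed

text \<open>
  A linear map sends the convex hull of a set onto the convex hull of its image.  The averaging map is
  linear on integrable functions only, so both inclusions are proved by checking convexity
  of the sets in question.
\<close>

lemma average_hull_eq_image:
  assumes "\<And>w j. w \<in> convex hull D \<Longrightarrow> integrable M (\<lambda>t. w t $ j)"
  shows "average_hull N I D = local_averages N I ` (convex hull D)"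
proof
  have "convex (local_averages N I ` (convex hull D))"
  proof (rule convexI, clarify)
    fix v w and a b :: real
    assume vw: "v \<in> convex hull D" "w \<in> convex hull D" and ab: "0 \<le> a" "0 \<le> b" "a + b = 1"
    show "a *\<^sub>R local_averages N I v + b *\<^sub>R local_averages N I w \<in> local_averages N I ` (convex hull D)"
      using local_averages_linear[of v w a b] assms vw convexD[OF convex_convex_hull vw ab] by force
  qed
  then show "average_hull N I D \<subseteq> local_averages N I ` (convex hull D)"
    unfolding average_hull_def by (intro hull_minimal image_mono hull_subset)
  have "convex {w \<in> convex hull D. local_averages N I w \<in> average_hull N I D}"
  proof (rule convexI, clarify, intro conjI)
    fix v w and a b :: real
    assume vw: "v \<in> convex hull D" "w \<in> convex hull D" and ab: "0 \<le> a" "0 \<le> b" "a + b = 1"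
      and A: "local_averages N I v \<in> average_hull N I D" "local_averages N I w \<in> average_hull N I D"
    show "a *\<^sub>R v + b *\<^sub>R w \<in> convex hull D" by (rule convexD[OF convex_convex_hull vw ab])
    have "a *\<^sub>R local_averages N I v + b *\<^sub>R local_averages N I w \<in> average_hull N I D"
      using A ab unfolding average_hull_def by (intro convexD[OF convex_convex_hull])
    then show "local_averages N I (a *\<^sub>R v + b *\<^sub>R w) \<in> average_hull N I D"
      using local_averages_linear[of v w a b] assms vw by simp
  qed
  then have "convex hull D \<subseteq> {w \<in> convex hull D. local_averages N I w \<in> average_hull N I D}"
    by (intro hull_minimal) (auto simp: hull_inc average_hull_def)
  then show "local_averages N I ` (convex hull D) \<subseteq> average_hull N I D" by blast
qed

lemma local_averages_tendsto:
  assumes v: "\<And>j. integrable M (\<lambda>t. v t $ j)" and w: "\<And>m j. integrable M (\<lambda>t. w m t $ j)"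
    and lim: "\<And>j. (\<lambda>m::nat. LINT t|M. \<bar>v t $ j - w m t $ j\<bar>) \<longlonglongrightarrow> 0"
  shows "(\<lambda>m. local_averages N I (w m)) \<longlonglongrightarrow> local_averages N I v"
proof -
  have "(\<lambda>m. local_averages N I (w m) (j, i)) \<longlonglongrightarrow> local_averages N I v (j, i)" for j i
  proof (cases "i \<in> {1..N}")
    case True
    have "\<bar>(LINT t|M. indicator (I i) t * w m t $ j) - (LINT t|M. indicator (I i) t * v t $ j)\<bar>
        \<le> (LINT t|M. \<bar>v t $ j - w m t $ j\<bar>)" for m
    proof -
      have int: "integrable M (\<lambda>t. indicator (I i) t * (w m t $ j - v t $ j))"
        using v w by (intro integrable_indicator_mult[OF True]) auto
      have "(LINT t|M. indicator (I i) t * w m t $ j) - (LINT t|M. indicator (I i) t * v t $ j)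
        = (LINT t|M. indicator (I i) t * (w m t $ j - v t $ j))"
        using integrable_indicator_mult[OF True v] integrable_indicator_mult[OF True w]
        by (simp add: right_diff_distrib)
      also have "\<bar>\<dots>\<bar> \<le> (LINT t|M. \<bar>indicator (I i) t * (w m t $ j - v t $ j)\<bar>)" by (rule integral_abs_bound)
      also have "\<dots> \<le> (LINT t|M. \<bar>v t $ j - w m t $ j\<bar>)"
      proof (rule integral_mono)
        show "integrable M (\<lambda>t. \<bar>indicator (I i) t * (w m t $ j - v t $ j)\<bar>)"
          by (rule integrable_abs[OF int])
        show "integrable M (\<lambda>t. \<bar>v t $ j - w m t $ j\<bar>)" using v w by auto
        show "\<bar>indicator (I i) t * (w m t $ j - v t $ j)\<bar> \<le> \<bar>v t $ j - w m t $ j\<bar>" for t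
          by (auto split: split_indicator)
      qed
      finally show ?thesis .
    qed
    then have "(\<lambda>m. (LINT t|M. indicator (I i) t * w m t $ j) - (LINT t|M. indicator (I i) t * v t $ j)) \<longlonglongrightarrow> 0"
      by (intro Lim_null_comparison[OF _ lim[of j]]) (auto intro!: always_eventually)
    then have "(\<lambda>m. LINT t|M. indicator (I i) t * w m t $ j) \<longlonglongrightarrow> (LINT t|M. indicator (I i) t * v t $ j)"
      by (rule LIM_zero_cancel)
    then show ?thesis using True by (simp add: local_averages_eq tendsto_divide cell_measure_pos less_imp_neq[symmetric])
  next
    case False
    then show ?thesis by (auto simp: local_averages_eq)
  qed
  then have "limitin (product_topology (\<lambda>_. euclidean) UNIV) (\<lambda>m. local_averages N I (w m)) (local_averages N I v) sequentially"
    by (auto simp: limitin_componentwise)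
  then show ?thesis by (simp add: euclidean_product_topology)
qed

end

context vanishing_mesh_partitions
begin

text \<open>
  A sequence in \<open>D\<close> has a subsequence that converges in \<open>L\<^sup>1\<close>.  Its limit has values in the unit cube,
  so the convergence also holds in \<open>L\<^sup>p\<close>, and the limit belongs to \<open>D\<close>.
\<close>

lemma compact_local_averages:
  fixes D :: "(real \<Rightarrow> real ^ 'n) set"
  assumes p: "p \<ge> 1" and closed: "Lp_closed T p D"
    and D: "\<And>u j. u \<in> D \<Longrightarrow> (\<lambda>t. u t $ j) \<in> unit_BV_ball T C"
  shows "compact (local_averages (N k) (I k) ` D)"
  unfolding compact_eq_seq_compact_metric seq_compact_def
proof (intro allI impI)
  fix x :: "nat \<Rightarrow> 'n \<times> nat \<Rightarrow> real"
  assume "\<forall>m. x m \<in> local_averages (N k) (I k) ` D"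
  then have "\<forall>m. \<exists>u. u \<in> D \<and> x m = local_averages (N k) (I k) u" by blast
  then obtain u where u: "\<And>m. u m \<in> D" "\<And>m. x m = local_averages (N k) (I k) (u m)" by metis
  obtain r g where r: "strict_mono r" and g: "\<And>j. integrable M (g j)"
    "\<And>j. (\<lambda>m. LINT t|M. \<bar>u (r m) t $ j - g j t\<bar>) \<longlonglongrightarrow> 0"
    by (rule unit_BV_ball_compact[of "\<lambda>m j t. u m t $ j"]) (use D[OF u(1)] in blast)+
  define v where "v t = (\<chi> j. g j t)" for t
  note ball = D[OF u(1)]
  have lim: "(\<lambda>m. LINT t|M. \<bar>v t $ j - u (r m) t $ j\<bar>) \<longlonglongrightarrow> 0" for j
    using g(2)[of j] by (simp add: v_def abs_minus_commute)
  have v_int: "integrable M (\<lambda>t. v t $ j)" for j using g(1) by (simp add: v_def)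
  have v_meas: "v \<in> borel_measurable M"
    by (rule borel_measurable_vecI) (use v_int in auto)
  have v_unit: "AE t in M. v t $ j \<in> {0..1}" for j
    by (rule AE_unit_of_L1_limit[OF v_int unit_BV_ballD(4)[OF ball] unit_BV_ballD(2)[OF ball] lim])
  have u_meas: "u m \<in> borel_measurable M" for m
    by (rule borel_measurable_vecI) (rule unit_BV_ballD(1)[OF ball])
  have Lp_lim: "(\<lambda>m. Lp_norm T p (\<lambda>t. v t - u (r m) t)) \<longlonglongrightarrow> 0"
    by (rule Lp_tendsto_of_L1_tendsto[OF p v_meas v_unit u_meas unit_BV_ballD(2)[OF ball] lim])
  have "\<exists>w\<in>D \<inter> Lp T p. Lp_norm T p (\<lambda>t. v t - w t) < \<epsilon>" if "\<epsilon> > 0" for \<epsilon>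
  proof -
    have "\<forall>\<^sub>F m in sequentially. Lp_norm T p (\<lambda>t. v t - u (r m) t) < \<epsilon>"
      using Lp_lim that by (rule order_tendstoD)
    then obtain m where "Lp_norm T p (\<lambda>t. v t - u (r m) t) < \<epsilon>" by (auto simp: eventually_sequentially)
    then show ?thesis using u(1) closed by (auto simp: Lp_closed_def)
  qed
  moreover have "v \<in> Lp T p" by (rule unit_cube_valued_in_Lp[OF v_meas v_unit p])
  ultimately have "v \<in> Lp_closure T p D" by (simp add: Lp_closure_def)
  then have "v \<in> D" using closed by (simp add: Lp_closed_def)
  moreover have "(x \<circ> r) \<longlonglongrightarrow> local_averages (N k) (I k) v"
    using interval_partition.local_averages_tendsto[OF partition v_int unit_BV_ballD(4)[OF ball] lim]
    by (simp add: comp_def u(2))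
  ultimately show "\<exists>l\<in>local_averages (N k) (I k) ` D. \<exists>r. strict_mono r \<and> (x \<circ> r) \<longlonglongrightarrow> l"
    using r by blast
qed

end

section \<open>The closed convex hull as an intersection of average relaxations\<close>

theorem theorem3p5:
  fixes T p :: real
    and D :: "(real \<Rightarrow> real ^ 'n) set"
    and N :: "nat \<Rightarrow> nat"
    and I :: "nat \<Rightarrow> nat \<Rightarrow> real set"
  assumes "T > 0" and "p \<ge> 1"
    and "D \<subseteq> {u \<in> BV T. AE t in lebesgue_on {0<..<T}. \<forall>j. u t $ j \<in> {0, 1}}"
    and "BV_bounded T D"
    and "Lp_closed T p D"
    and "\<And>k i. i \<in> {1..N k} \<Longrightarrow>
           I k i \<noteq> {} \<and> open (I k i) \<and> is_interval (I k i) \<and> I k i \<subseteq> {0<..<T}"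
    and "\<And>k. disjoint_family_on (I k) {1..N k}"
    and "\<And>k. (\<Union>i\<in>{1..N k}. closure (I k i)) = {0..T}"
    and "(\<lambda>k. Max ((\<lambda>i. measure lebesgue (I k i)) ` {1..N k})) \<longlonglongrightarrow> 0"
  shows "Lp_closure T p (convex hull D) = (\<Inter>k. average_relaxation T p (N k) (I k) D)"
proof -
  let ?M = "lebesgue_on {0<..<T}"
  have partition: "interval_partition T (N k) (I k)" for k
    using assms(1,6,7,8) by unfold_locales auto
  interpret vanishing_mesh_partitions T N I
    using assms(9) by (intro vanishing_mesh_partitions.intro partition) (simp add: interval_partition.mesh_def[OF partition])
  obtain C where C: "\<And>u. u \<in> D \<Longrightarrow> BV_norm T u \<le> ereal C"
    using assms(4) by (auto simp: BV_bounded_def)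
  have D: "(\<lambda>t. u t $ j) \<in> unit_BV_ball T C" if "u \<in> D" for u j
    using assms(3) that C[OF that] by (intro component_in_unit_BV_ball) auto
  then have "convex hull D \<subseteq> {w. \<forall>j. (\<lambda>t. w t $ j) \<in> unit_BV_ball T C}"
    by (intro hull_minimal convex_unit_BV_ball) auto
  then have hull: "(\<lambda>t. w t $ j) \<in> unit_BV_ball T C" if "w \<in> convex hull D" for w j
    using that by blast
  have hull_int: "integrable ?M (\<lambda>t. w t $ j)" if "w \<in> convex hull D" for w j
    using unit_BV_ballD(4)[OF hull[OF that]] .
  have hull_meas: "w \<in> borel_measurable ?M" if "w \<in> convex hull D" for w
    by (rule borel_measurable_vecI) (rule unit_BV_ballD(1)[OF hull[OF that]])
  have hull_Lp: "w \<in> Lp T p" if "w \<in> convex hull D" for w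
    by (rule unit_cube_valued_in_Lp[OF hull_meas[OF that] unit_BV_ballD(2)[OF hull[OF that]] assms(2)])
  have image: "average_hull (N k) (I k) D = local_averages (N k) (I k) ` (convex hull D)" for k
    by (rule interval_partition.average_hull_eq_image[OF partition hull_int])
  show ?thesis
  proof (intro equalityI subsetI INT_I)
    fix v k assume v: "v \<in> Lp_closure T p (convex hull D)"
    then have v_Lp: "v \<in> Lp T p" by (simp add: Lp_closure_def)
    have "\<exists>w\<in>convex hull D. Lp_norm T p (\<lambda>t. v t - w t) < inverse (real (Suc m))" for m
    proof -
      have "inverse (real (Suc m)) > 0" by simp
      then show ?thesis using v unfolding Lp_closure_def by blast
    qed
    then obtain w where w: "\<And>m. w m \<in> convex hull D"
      "\<And>m. Lp_norm T p (\<lambda>t. v t - w m t) < inverse (real (Suc m))" by metis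
    have "(\<lambda>m. Lp_norm T p (\<lambda>t. v t - w m t)) \<longlonglongrightarrow> 0"
      by (rule tendsto_sandwich[OF _ _ tendsto_const LIMSEQ_inverse_real_of_nat])
         (use w(2) in \<open>auto intro!: always_eventually less_imp_le simp: Lp_norm_def\<close>)
    then have "(\<lambda>m. LINT t|?M. \<bar>v t $ j - w m t $ j\<bar>) \<longlonglongrightarrow> 0" for j
      by (rule L1_tendsto_of_Lp_tendsto[OF assms(1,2) v_Lp hull_Lp[OF w(1)]])
    then have "(\<lambda>m. local_averages (N k) (I k) (w m)) \<longlonglongrightarrow> local_averages (N k) (I k) v"
      by (rule interval_partition.local_averages_tendsto[OF partition Lp_component_L1(1)[OF v_Lp assms(2)] hull_int[OF w(1)]])
    moreover have "closed (average_hull (N k) (I k) D)"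
      unfolding average_hull_def
    proof (intro compact_imp_closed compact_convex_hull_fun[where F = "UNIV \<times> {1..N k}"])
      show "compact (local_averages (N k) (I k) ` D)"
        by (rule compact_local_averages[OF assms(2,5) D])
    qed (auto simp: local_averages_def split: if_splits)
    moreover have "local_averages (N k) (I k) (w m) \<in> average_hull (N k) (I k) D" for m
      unfolding image using w(1) by blast
    ultimately have "local_averages (N k) (I k) v \<in> average_hull (N k) (I k) D"
      by (rule closed_sequentially[rotated 2]) 
    then show "v \<in> average_relaxation T p (N k) (I k) D"
      using v_Lp by (simp add: average_relaxation_def)
  next
    fix v assume "v \<in> (\<Inter>k. average_relaxation T p (N k) (I k) D)"
    then have v_Lp: "v \<in> Lp T p" and "\<forall>k. local_averages (N k) (I k) v \<in> average_hull (N k) (I k) D"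
      by (auto simp: average_relaxation_def)
    then have "\<forall>k. \<exists>w. w \<in> convex hull D \<and> local_averages (N k) (I k) v = local_averages (N k) (I k) w"
      unfolding image by blast
    then obtain w where w: "\<And>k. w k \<in> convex hull D"
      "\<And>k. local_averages (N k) (I k) v = local_averages (N k) (I k) (w k)" by metis
    have v_int: "integrable ?M (\<lambda>t. v t $ j)" for j by (rule Lp_component_L1(1)[OF v_Lp assms(2)])
    have lim: "(\<lambda>k. LINT t|?M. \<bar>v t $ j - w k t $ j\<bar>) \<longlonglongrightarrow> 0" for j
    proof (rule L1_tendsto_of_equal_cell_integrals[OF v_int hull[OF w(1)]])
      fix k i assume i: "i \<in> {1..N k}"
      show "(LINT t|?M. indicator (I k i) t * v t $ j) = (LINT t|?M. indicator (I k i) t * w k t $ j)"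
        using fun_cong[OF w(2)[of k], of "(j, i)"] i interval_partition.cell_measure_pos[OF partition i]
        by (simp add: interval_partition.local_averages_eq[OF partition])
    qed
    have v_unit: "AE t in ?M. v t $ j \<in> {0..1}" for j
      by (rule AE_unit_of_L1_limit[OF v_int hull_int[OF w(1)] unit_BV_ballD(2)[OF hull[OF w(1)]] lim])
    have "(\<lambda>k. Lp_norm T p (\<lambda>t. v t - w k t)) \<longlonglongrightarrow> 0"
      using v_Lp by (intro Lp_tendsto_of_L1_tendsto[OF assms(2) _ v_unit hull_meas[OF w(1)] unit_BV_ballD(2)[OF hull[OF w(1)]] lim])
                    (simp add: Lp_def)
    then have "\<exists>k. Lp_norm T p (\<lambda>t. v t - w k t) < \<epsilon>" if "\<epsilon> > 0" for \<epsilon>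
      using order_tendstoD(2)[OF _ that] by (fastforce simp: eventually_sequentially)
    then show "v \<in> Lp_closure T p (convex hull D)"
      using v_Lp w(1) hull_Lp unfolding Lp_closure_def by blast
  qed
qed

end
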